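(* Let $\mathcal{D}_R$ be the set of all relational databases, $\mathcal{D}_G$ the set of all graph databases, and $CM:\mathcal{D}_R\to\mathcal{D}_G$ the complete mapping defined in the context. Then $CM$ is information preserving: there is a computable mapping $CM^{-1}:\mathcal{D}_G\to\mathcal{D}_R$ such that $CM^{-1}(CM(D_R))=D_R$ for every $D_R\in\mathcal{D}_R$.
   Context: **Basic sets.** $\mathcal{R}$ is an infinite set of relation names; $\mathcal{A}$ is an infinite set of attribute names containing a special attribute $tid$ and a special attribute $vid$; $\mathcal{T}=\{String, Date, Integer, Float, Boolean, Object\}$ is the set of types; $\mathcal{D}$ is a countably infinite domain of data values containing a special value NULL. **Relational databases.** A relational schema is $S_R=(R,A,T,\Sigma)$ where: $R\subseteq\mathcal{R}$ is finite; $A$ assigns to each $r\in R$ a finite set $A(r)\subseteq\mathcal{A}\setminus\{tid,vid\}$; $T$ assigns to each attribute $a\in A(r)$ of each relation $r$ a type $T(a)\in\mathcal{T}$ (depending on $r$ and $a$); $\Sigma$ is a finite set of primary and foreign keys. A primary key over $r\in R$ is an expression $r[a_1,\dots,a_n]$ with $a_1,\dots,a_n\in A(r)$; each relation has at most one primary key in $\Sigma$. A foreign key over $r,s\in R$ is an expression $r[a_1,\dots,a_n]\to s[b_1,\dots,b_n]$ with $a_1,\dots,a_n\in A(r)$ and $s[b_1,\dots,b_n]\in\Sigma$. An instance $I_R$ of $S_R$ assigns to each $r\in R$ a finite set $I(r)$ of tuples; each tuple is a function $t:A(r)\cup\{tid\}\to\mathcal{D}$ with $t(tid)\neq$ NULL,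 and distinct tuples of $I(r)$ have distinct $tid$ values. Values respect the declared types (NULL is allowed for every type), and $tid$ values are integers. A relational database is $D_R=(S_R,I_R)$; $I_R$ is not required to satisfy $\Sigma$. **Graph databases.** Graphs are directed multi-graphs (parallel edges are allowed); the start and end vertices of an edge $e$ are $e.s$ and $e.d$, and we write $e=(e.s,e.d)$. A schema graph is $S_G=(V_S,E_S,L_S,A_S,Pk,Fk)$ where $V_S,E_S$ are finite sets of vertices and directed edges; $L_S$ assigns a label to each vertex and edge; $A_S$ assigns to each vertex and edge a finite set of pairs $(a:t)$ with $a\in\mathcal{A}$, $t\in\mathcal{T}$ (possibly empty for edges); $Pk$ is a partial function assigning to a vertex $v$ a list of attributes occurring in $A_S(v)$; and for each edge $e$, $Fk(e,s)$ (resp. $Fk(e,d)$) is a list of attributes occurring in $A_S(e.s)$ (resp. $A_S(e.d)$). An instance graph of $S_G$ is a property graph $I_G=(V_I,E_I,L_I,A_I)$, with labels $L_I$ on vertices and edges and finite sets $A_I$ of attribute-value pairs $(a:c)$ on vertices and edges, such that: (i) each $v_i\in V_I$ corresponds to some $v_s\in V_S$, written $v_i\sim v_s$, meaning $L_I(v_i)=L_S(v_s)$ and for each $(a:c)\in A_I(v_i)$ there is $(a:t)\in A_S(v_s)$ with $c$ of type $t$; (ii) each edge $e_i=(v_i,w_i)\in E_I$ corresponds to some edge $e_s=(v_s,w_s)\in E_S$, meaning $L_I(e_i)=L_S(e_s)$, for each $(a:c)\in A_I(e_i)$ there is $(a:t)\in A_S(e_s)$ with $c$ of type $t$, and $v_i\sim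 v_s$, $w_i\sim w_s$. A graph database is $D_G=(S_G,I_G)$ with $I_G$ an instance graph of $S_G$. **The complete mapping $CM$.** For $D_R=(S_R,I_R)$ with $S_R=(R,A,T,\Sigma)$, $CM(D_R)=(S_G,I_G)$ consists exactly of the following. *Schema mapping.* (1) One vertex $v_r\in V_S$ with $L_S(v_r)=r$ for each $r\in R$. (2) For each $a\in A(r)$ with $T(a)=t$, $(a:t)\in A_S(v_r)$. (3) For each primary key $r[a_1,\dots,a_n]\in\Sigma$, $Pk(v_r)=(a_1,\dots,a_n)$. (4) For each foreign key $r[a_1,\dots,a_n]\to s[b_1,\dots,b_n]\in\Sigma$, an edge $e=(v_r,v_s)\in E_S$ with label $L_S(e)=r\text{-}s$, $Fk(e,s)=(a_1,\dots,a_n)$ and $Fk(e,d)=(b_1,\dots,b_n)$ (here the second argument "$s$"/"$d$" of $Fk$ stands for "source"/"destination"). (5) The special pair $(vid:Integer)$ is in $A_S(v)$ for every vertex $v$. *Instance mapping.* (1) One vertex $v_t\in V_I$ with $L_I(v_t)=r$ for each $r\in R$ and each tuple $t\in I(r)$. (2) For each attribute $a\in A(r)$ with $t(a)=c$, $(a:c)\in A_I(v_t)$; and $(vid:t(tid))\in A_I(v_t)$. (3) For each foreign key $r[a_1,\dots,a_n]\to s[b_1,\dots,b_n]$ in $\Sigma$ and all $t\in I(r)$, $t'\in I(s)$ with $t(a_i)=t'(b_i)$ for every $i\in\{1,\dots,n\}$, an edge $e=(v_t,v_{t'})\in E_I$ with $L_I(e)=r\text{-}s$. "Computable" is with respect to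 a standard finite encoding of relational and graph databases. *)

theory Defs
  imports
    "HOL-Library.FuncSet"
    "HOL-Library.Nat_Bijection"
    "Graph_Theory.Digraph"
begin

text \<open>
  Relation names, attribute names and data values are the elements of the type variables
  \<open>'r\<close>, \<open>'a\<close> and \<open>'d\<close>. The special attributes, the value \<open>NULL\<close> and the typing of values are
  parameters: \<open>vals ty\<close> is the set of values of type \<open>ty\<close>, and \<open>NULL\<close> is meant to belong to each of
  these sets. Functions on finite sets are extensional (equal to \<open>undefined\<close> outside their domain),
  so that equality of databases is HOL equality.
\<close>

section \<open>Relational databases\<close>

datatype data_type = String | Date | Integer | Float | Boolean | Object

datatype ('r, 'a) key =
  Primary_Key 'r "'a list"
| Foreign_Key 'r "'a list" 'r "'a list"

record ('r, 'a) rel_schema =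
  rels :: "'r set"
  attrs :: "'r \<Rightarrow> 'a set"
  attr_type :: "'r \<Rightarrow> 'a \<Rightarrow> data_type"
  keys :: "('r, 'a) key set"

definition wf_key :: "('r, 'a) rel_schema \<Rightarrow> ('r, 'a) key \<Rightarrow> bool" where
  "wf_key S k \<longleftrightarrow> (case k of
      Primary_Key r as \<Rightarrow> r \<in> rels S \<and> set as \<subseteq> attrs S r
    | Foreign_Key r as s bs \<Rightarrow>
        r \<in> rels S \<and> s \<in> rels S \<and> set as \<subseteq> attrs S r \<and> length as = length bs \<and>
        Primary_Key s bs \<in> keys S)"

definition rel_schemas :: "'a \<Rightarrow> 'a \<Rightarrow> ('r, 'a) rel_schema set" where
  "rel_schemas tid vid = {S.
     finite (rels S) \<and>
     attrs S \<in> rels S \<rightarrow>\<^sub>E {X. finite X \<and> X \<subseteq> UNIV - {tid, vid}} \<and>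
     attr_type S \<in> (\<Pi>\<^sub>E r\<in>rels S. attrs S r \<rightarrow>\<^sub>E UNIV) \<and>
     finite (keys S) \<and>
     (\<forall>k\<in>keys S. wf_key S k) \<and>
     (\<forall>r as as'. Primary_Key r as \<in> keys S \<longrightarrow> Primary_Key r as' \<in> keys S \<longrightarrow> as = as')}"

definition rel_tuples ::
  "'a \<Rightarrow> 'd \<Rightarrow> (data_type \<Rightarrow> 'd set) \<Rightarrow> ('r, 'a) rel_schema \<Rightarrow> 'r \<Rightarrow> ('a \<Rightarrow> 'd) set" where
  "rel_tuples tid null vals S r =
     (\<Pi>\<^sub>E a\<in>insert tid (attrs S r).
        if a = tid then vals Integer - {null} else vals (attr_type S r a))"

definition rel_instances ::
  "'a \<Rightarrow> 'd \<Rightarrow> (data_type \<Rightarrow> 'd set) \<Rightarrow> ('r, 'a) rel_schema \<Rightarrow> ('r \<Rightarrow> ('a \<Rightarrow> 'd) set) set" where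
  "rel_instances tid null vals S =
     (\<Pi>\<^sub>E r\<in>rels S. {X. finite X \<and> X \<subseteq> rel_tuples tid null vals S r \<and> inj_on (\<lambda>t. t tid) X})"

text \<open>Instances need not satisfy the keys of their schema.\<close>

type_synonym ('r, 'a, 'd) rel_db = "('r, 'a) rel_schema \<times> ('r \<Rightarrow> ('a \<Rightarrow> 'd) set)"

definition rel_dbs ::
  "'a \<Rightarrow> 'a \<Rightarrow> 'd \<Rightarrow> (data_type \<Rightarrow> 'd set) \<Rightarrow> ('r, 'a, 'd) rel_db set" where
  "rel_dbs tid vid null vals =
     {(S, I). S \<in> rel_schemas tid vid \<and> I \<in> rel_instances tid null vals S}"


section \<open>Graph databases\<close>

text \<open>The label of the edges obtained from a foreign key from \<open>r\<close> to \<open>s\<close> is \<open>Dash r s\<close>.\<close>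

datatype 'r label = Name 'r | Dash 'r 'r

text \<open>
  Vertices and edges are anonymous: both are drawn from the natural numbers. The annotations \<open>'p\<close>
  are attribute-type pairs in schema graphs and attribute-value pairs in instance graphs.
\<close>

record ('r, 'p) property_graph =
  graph :: "(nat, nat) pre_digraph"
  vlabel :: "nat \<Rightarrow> 'r label"
  elabel :: "nat \<Rightarrow> 'r label"
  vprops :: "nat \<Rightarrow> 'p set"
  eprops :: "nat \<Rightarrow> 'p set"

record ('r, 'a) schema_graph = "('r, 'a \<times> data_type) property_graph" +
  pk :: "nat \<Rightarrow> 'a list option"
  fk_source :: "nat \<Rightarrow> 'a list"
  fk_dest :: "nat \<Rightarrow> 'a list"

abbreviation gverts :: "('r, 'p, 'm) property_graph_scheme \<Rightarrow> nat set" where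
  "gverts G \<equiv> verts (graph G)"

abbreviation garcs :: "('r, 'p, 'm) property_graph_scheme \<Rightarrow> nat set" where
  "garcs G \<equiv> arcs (graph G)"

abbreviation gtail :: "('r, 'p, 'm) property_graph_scheme \<Rightarrow> nat \<Rightarrow> nat" where
  "gtail G \<equiv> tail (graph G)"

abbreviation ghead :: "('r, 'p, 'm) property_graph_scheme \<Rightarrow> nat \<Rightarrow> nat" where
  "ghead G \<equiv> head (graph G)"

definition wf_property_graph :: "('r, 'p, 'm) property_graph_scheme \<Rightarrow> bool" where
  "wf_property_graph G \<longleftrightarrow>
     fin_digraph (graph G) \<and>
     gtail G \<in> extensional (garcs G) \<and>
     ghead G \<in> extensional (garcs G) \<and>
     vlabel G \<in> extensional (gverts G) \<and>
     elabel G \<in> extensional (garcs G) \<and>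
     vprops G \<in> gverts G \<rightarrow>\<^sub>E {X. finite X} \<and>
     eprops G \<in> garcs G \<rightarrow>\<^sub>E {X. finite X}"

definition schema_graphs :: "('r, 'a) schema_graph set" where
  "schema_graphs = {S.
     wf_property_graph S \<and>
     pk S \<in> extensional (gverts S) \<and>
     (\<forall>v\<in>gverts S. \<forall>as. pk S v = Some as \<longrightarrow> set as \<subseteq> fst ` vprops S v) \<and>
     fk_source S \<in> (\<Pi>\<^sub>E e\<in>garcs S. {as. set as \<subseteq> fst ` vprops S (gtail S e)}) \<and>
     fk_dest S \<in> (\<Pi>\<^sub>E e\<in>garcs S. {as. set as \<subseteq> fst ` vprops S (ghead S e)})}"

definition props_conform ::
  "(data_type \<Rightarrow> 'd set) \<Rightarrow> ('a \<times> 'd) set \<Rightarrow> ('a \<times> data_type) set \<Rightarrow> bool" where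
  "props_conform vals P Q \<longleftrightarrow> (\<forall>(a, c)\<in>P. \<exists>ty. (a, ty) \<in> Q \<and> c \<in> vals ty)"

definition vertex_corresponds ::
  "(data_type \<Rightarrow> 'd set) \<Rightarrow> ('r, 'a) schema_graph \<Rightarrow> ('r, 'a \<times> 'd) property_graph
     \<Rightarrow> nat \<Rightarrow> nat \<Rightarrow> bool" where
  "vertex_corresponds vals S I v w \<longleftrightarrow>
     vlabel I v = vlabel S w \<and> props_conform vals (vprops I v) (vprops S w)"

definition edge_corresponds ::
  "(data_type \<Rightarrow> 'd set) \<Rightarrow> ('r, 'a) schema_graph \<Rightarrow> ('r, 'a \<times> 'd) property_graph
     \<Rightarrow> nat \<Rightarrow> nat \<Rightarrow> bool" where
  "edge_corresponds vals S I e f \<longleftrightarrow>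
     elabel I e = elabel S f \<and>
     props_conform vals (eprops I e) (eprops S f) \<and>
     vertex_corresponds vals S I (gtail I e) (gtail S f) \<and>
     vertex_corresponds vals S I (ghead I e) (ghead S f)"

definition instance_graphs ::
  "(data_type \<Rightarrow> 'd set) \<Rightarrow> ('r, 'a) schema_graph \<Rightarrow> ('r, 'a \<times> 'd) property_graph set" where
  "instance_graphs vals S = {I.
     wf_property_graph I \<and>
     (\<forall>v\<in>gverts I. \<exists>w\<in>gverts S. vertex_corresponds vals S I v w) \<and>
     (\<forall>e\<in>garcs I. \<exists>f\<in>garcs S. edge_corresponds vals S I e f)}"

type_synonym ('r, 'a, 'd) graph_db = "('r, 'a) schema_graph \<times> ('r, 'a \<times> 'd) property_graph"

definition graph_dbs :: "(data_type \<Rightarrow> 'd set) \<Rightarrow> ('r, 'a, 'd) graph_db set" where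
  "graph_dbs vals = {(S, I). S \<in> schema_graphs \<and> I \<in> instance_graphs vals S}"


section \<open>The complete mapping\<close>

definition foreign_keys :: "('r, 'a) rel_schema \<Rightarrow> ('r \<times> 'a list \<times> 'r \<times> 'a list) set" where
  "foreign_keys S = {(r, as, s, bs). Foreign_Key r as s bs \<in> keys S}"

text \<open>
  The complete mapping prescribes its result only up to the identity of vertices and edges. The
  bijections \<open>vS\<close>, \<open>eS\<close>, \<open>vI\<close>, \<open>eI\<close> name the vertices and edges of the two graphs; in particular,
  \<open>vS r\<close> and \<open>vI (r, t)\<close> are the vertices $v_r$ and $v_t$.
\<close>

definition complete_schema_graph ::
  "'a \<Rightarrow> ('r, 'a) rel_schema \<Rightarrow> ('r, 'a) schema_graph \<Rightarrow> bool" where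
  "complete_schema_graph vid S G \<longleftrightarrow> (\<exists>vS eS.
     bij_betw vS (rels S) (gverts G) \<and>
     bij_betw eS (foreign_keys S) (garcs G) \<and>
     (\<forall>r\<in>rels S.
        vlabel G (vS r) = Name r \<and>
        vprops G (vS r) = {(a, attr_type S r a) | a. a \<in> attrs S r} \<union> {(vid, Integer)} \<and>
        (\<forall>as. pk G (vS r) = Some as \<longleftrightarrow> Primary_Key r as \<in> keys S)) \<and>
     (\<forall>(r, as, s, bs)\<in>foreign_keys S.
        let e = eS (r, as, s, bs) in
          gtail G e = vS r \<and> ghead G e = vS s \<and>
          elabel G e = Dash r s \<and> eprops G e = {} \<and>
          fk_source G e = as \<and> fk_dest G e = bs))"

definition complete_instance_graph ::
  "'a \<Rightarrow> 'a \<Rightarrow> ('r, 'a) rel_schema \<Rightarrow> ('r \<Rightarrow> ('a \<Rightarrow> 'd) set)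
     \<Rightarrow> ('r, 'a \<times> 'd) property_graph \<Rightarrow> bool" where
  "complete_instance_graph tid vid S I G \<longleftrightarrow> (\<exists>vI eI.
     bij_betw vI (SIGMA r:rels S. I r) (gverts G) \<and>
     bij_betw eI
       {(k, t, t') | k t t'. case k of (r, as, s, bs) \<Rightarrow>
          k \<in> foreign_keys S \<and> t \<in> I r \<and> t' \<in> I s \<and> map t as = map t' bs}
       (garcs G) \<and>
     (\<forall>r\<in>rels S. \<forall>t\<in>I r.
        vlabel G (vI (r, t)) = Name r \<and>
        vprops G (vI (r, t)) = {(a, t a) | a. a \<in> attrs S r} \<union> {(vid, t tid)}) \<and>
     (\<forall>(r, as, s, bs)\<in>foreign_keys S. \<forall>t\<in>I r. \<forall>t'\<in>I s. map t as = map t' bs \<longrightarrow>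
        (let e = eI ((r, as, s, bs), t, t') in
          gtail G e = vI (r, t) \<and> ghead G e = vI (s, t') \<and>
          elabel G e = Dash r s \<and> eprops G e = {})))"

text \<open>
  The mappings that satisfy the following predicate differ only in their choice of vertex and edge
  identities.
\<close>

definition complete_mapping ::
  "'a \<Rightarrow> 'a \<Rightarrow> 'd \<Rightarrow> (data_type \<Rightarrow> 'd set)
     \<Rightarrow> (('r, 'a, 'd) rel_db \<Rightarrow> ('r, 'a, 'd) graph_db) \<Rightarrow> bool" where
  "complete_mapping tid vid null vals CM \<longleftrightarrow>
     CM \<in> rel_dbs tid vid null vals \<rightarrow> graph_dbs vals \<and>
     (\<forall>(S, I)\<in>rel_dbs tid vid null vals. case CM (S, I) of (SG, IG) \<Rightarrow>
        complete_schema_graph vid S SG \<and> complete_instance_graph tid vid S I IG)"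


section \<open>Computability\<close>

text \<open>
  Partial recursive functions. \<open>rec_eval p xs y\<close> states that the program \<open>p\<close> halts on the
  arguments \<open>xs\<close> with the result \<open>y\<close>.
\<close>

datatype rec_prog =
  Zero
| Succ
| Proj nat
| Comp rec_prog "rec_prog list"
| Prim_Rec rec_prog rec_prog
| Minimize rec_prog

inductive rec_eval :: "rec_prog \<Rightarrow> nat list \<Rightarrow> nat \<Rightarrow> bool" where
  Zero: "rec_eval Zero xs 0"
| Succ: "rec_eval Succ [x] (Suc x)"
| Proj: "i < length xs \<Longrightarrow> rec_eval (Proj i) xs (xs ! i)"
| Comp: "list_all2 (\<lambda>q y. rec_eval q xs y) qs ys \<Longrightarrow> rec_eval p ys z \<Longrightarrow>
    rec_eval (Comp p qs) xs z"
| Prim_Rec_0: "rec_eval p xs y \<Longrightarrow> rec_eval (Prim_Rec p q) (0 # xs) y"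
| Prim_Rec_Suc: "rec_eval (Prim_Rec p q) (n # xs) y \<Longrightarrow> rec_eval q (n # y # xs) z \<Longrightarrow>
    rec_eval (Prim_Rec p q) (Suc n # xs) z"
| Minimize: "rec_eval p (n # xs) 0 \<Longrightarrow> (\<And>m. m < n \<Longrightarrow> \<exists>y. rec_eval p (m # xs) (Suc y)) \<Longrightarrow>
    rec_eval (Minimize p) xs n"

definition computable_on ::
  "'x set \<Rightarrow> ('x \<Rightarrow> nat) \<Rightarrow> ('y \<Rightarrow> nat) \<Rightarrow> ('x \<Rightarrow> 'y) \<Rightarrow> bool" where
  "computable_on X encx ency f \<longleftrightarrow> (\<exists>p. \<forall>x\<in>X. rec_eval p [encx x] (ency (f x)))"

text \<open>
  The encoding of databases is built from numberings \<open>er\<close>, \<open>ea\<close>, \<open>ed\<close> of the relation names, the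
  attribute names and the data values.
\<close>

definition enc_set :: "('x \<Rightarrow> nat) \<Rightarrow> 'x set \<Rightarrow> nat" where
  "enc_set encx X = set_encode (encx ` X)"

definition enc_list :: "('x \<Rightarrow> nat) \<Rightarrow> 'x list \<Rightarrow> nat" where
  "enc_list encx xs = list_encode (map encx xs)"

definition enc_pair :: "('x \<Rightarrow> nat) \<Rightarrow> ('y \<Rightarrow> nat) \<Rightarrow> 'x \<times> 'y \<Rightarrow> nat" where
  "enc_pair encx ency = (\<lambda>(x, y). prod_encode (encx x, ency y))"

definition enc_option :: "('x \<Rightarrow> nat) \<Rightarrow> 'x option \<Rightarrow> nat" where
  "enc_option encx z = (case z of None \<Rightarrow> 0 | Some x \<Rightarrow> Suc (encx x))"

text \<open>A function on a finite domain is encoded by its graph.\<close>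

definition enc_fun :: "'x set \<Rightarrow> ('x \<Rightarrow> nat) \<Rightarrow> ('y \<Rightarrow> nat) \<Rightarrow> ('x \<Rightarrow> 'y) \<Rightarrow> nat" where
  "enc_fun X encx ency f = enc_set (enc_pair encx ency) ((\<lambda>x. (x, f x)) ` X)"

definition enc_data_type :: "data_type \<Rightarrow> nat" where
  "enc_data_type ty = (case ty of
     String \<Rightarrow> 0 | Date \<Rightarrow> 1 | Integer \<Rightarrow> 2 | Float \<Rightarrow> 3 | Boolean \<Rightarrow> 4 | Object \<Rightarrow> 5)"

definition enc_key :: "('r \<Rightarrow> nat) \<Rightarrow> ('a \<Rightarrow> nat) \<Rightarrow> ('r, 'a) key \<Rightarrow> nat" where
  "enc_key er ea k = (case k of
     Primary_Key r as \<Rightarrow> list_encode [er r, enc_list ea as]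
   | Foreign_Key r as s bs \<Rightarrow> list_encode [er r, enc_list ea as, er s, enc_list ea bs])"

definition enc_rel_schema :: "('r \<Rightarrow> nat) \<Rightarrow> ('a \<Rightarrow> nat) \<Rightarrow> ('r, 'a) rel_schema \<Rightarrow> nat" where
  "enc_rel_schema er ea S = list_encode [
     enc_set er (rels S),
     enc_fun (rels S) er (enc_set ea) (attrs S),
     enc_fun (SIGMA r:rels S. attrs S r) (enc_pair er ea) enc_data_type
       (\<lambda>(r, a). attr_type S r a),
     enc_set (enc_key er ea) (keys S)]"

definition enc_rel_db ::
  "'a \<Rightarrow> ('r \<Rightarrow> nat) \<Rightarrow> ('a \<Rightarrow> nat) \<Rightarrow> ('d \<Rightarrow> nat) \<Rightarrow> ('r, 'a, 'd) rel_db \<Rightarrow> nat" where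
  "enc_rel_db tid er ea ed = (\<lambda>(S, I). list_encode [
     enc_rel_schema er ea S,
     enc_set (\<lambda>(r, t). prod_encode (er r, enc_fun (insert tid (attrs S r)) ea ed t))
       (SIGMA r:rels S. I r)])"

definition enc_label :: "('r \<Rightarrow> nat) \<Rightarrow> 'r label \<Rightarrow> nat" where
  "enc_label er l = (case l of
     Name r \<Rightarrow> list_encode [er r]
   | Dash r s \<Rightarrow> list_encode [er r, er s])"

definition enc_property_graph ::
  "('r \<Rightarrow> nat) \<Rightarrow> ('p \<Rightarrow> nat) \<Rightarrow> ('r, 'p, 'm) property_graph_scheme \<Rightarrow> nat" where
  "enc_property_graph er ep G = list_encode [
     enc_set id (gverts G),
     enc_set id (garcs G),
     enc_fun (garcs G) id id (gtail G),
     enc_fun (garcs G) id id (ghead G),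
     enc_fun (gverts G) id (enc_label er) (vlabel G),
     enc_fun (garcs G) id (enc_label er) (elabel G),
     enc_fun (gverts G) id (enc_set ep) (vprops G),
     enc_fun (garcs G) id (enc_set ep) (eprops G)]"

definition enc_schema_graph :: "('r \<Rightarrow> nat) \<Rightarrow> ('a \<Rightarrow> nat) \<Rightarrow> ('r, 'a) schema_graph \<Rightarrow> nat" where
  "enc_schema_graph er ea G = list_encode [
     enc_property_graph er (enc_pair ea enc_data_type) G,
     enc_fun (gverts G) id (enc_option (enc_list ea)) (pk G),
     enc_fun (garcs G) id (enc_list ea) (fk_source G),
     enc_fun (garcs G) id (enc_list ea) (fk_dest G)]"

definition enc_graph_db ::
  "('r \<Rightarrow> nat) \<Rightarrow> ('a \<Rightarrow> nat) \<Rightarrow> ('d \<Rightarrow> nat) \<Rightarrow> ('r, 'a, 'd) graph_db \<Rightarrow> nat" where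
  "enc_graph_db er ea ed = (\<lambda>(S, I). list_encode [
     enc_schema_graph er ea S,
     enc_property_graph er (enc_pair ea ed) I])"

end

theory Submission
  imports Defs
begin

text \<open>
  The relational database is read off the vertices of the two graphs and the foreign keys of the
  schema edges: the label of a vertex is the relation, its properties other than \<open>vid\<close> are the
  attributes or the tuple, and the value of \<open>vid\<close> is that of \<open>tid\<close>. Whether the result is a relational
  database can be decided from the graph database alone although the typing of values need not be
  decidable: an instance graph conforms to its schema graph, so its values have the right types as
  soon as the label of a schema vertex determines it and every attribute has one type. On the other
  graph databases the inverse returns the empty database. Sets, functions and lists are coded by
  numbers, and the recursive functions are closed under the bounded quantifiers, images and unions
  over coded sets by which decoding is expressed.
\<close>

section \<open>Recursive functions\<close>

text \<open>A complete mapping fixes its result only up to the names of vertices and edges, so the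
  inverse must not depend on them: a schema vertex is recognized by its label, an instance vertex by
  its label together with its \<open>vid\<close> value. One and the same inverse then serves every
  complete mapping. The numberings \<open>er\<close>, \<open>ea\<close>, \<open>ed\<close> are
  merely injective, and their ranges need not be decidable. Hence the program never turns a number
  back into a name: it compares and copies numbers that occur in its input, and of the names and
  values it has only \<open>tid\<close>, \<open>vid\<close> and \<open>NULL\<close> built in. Since
  \<open>set_encode\<close> is canonical, the output does not depend on the order in which a set is
  collected. Everything exists on two levels, \<open>decodable_db\<close> and
  \<open>decode_db\<close> for databases, \<open>decodable_code\<close> and
  \<open>decode_code\<close> for numbers; they have to agree only on codes of graph
  databases.\<close>

text \<open>\<open>A\<close> lists the arguments that a program reads off the context \<open>c\<close>.\<close>

definition computes :: "('c \<Rightarrow> nat list) \<Rightarrow> ('c \<Rightarrow> nat) \<Rightarrow> bool" where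
  "computes A f \<longleftrightarrow> (\<exists>p. \<forall>c. rec_eval p (A c) (f c))"

abbreviation recursive :: "(nat \<Rightarrow> nat) \<Rightarrow> bool" where
  "recursive \<equiv> computes (\<lambda>x. [x])"

abbreviation recursive2 :: "(nat \<Rightarrow> nat \<Rightarrow> nat) \<Rightarrow> bool" where
  "recursive2 f \<equiv> computes (\<lambda>c. [fst c, snd c]) (\<lambda>c. f (fst c) (snd c))"

section \<open>Composition, primitive recursion and minimization\<close>

lemma computes_nth: "(\<And>c. i < length (A c)) \<Longrightarrow> (\<And>c. f c = A c ! i) \<Longrightarrow> computes A f"
  unfolding computes_def using rec_eval.Proj by (metis (no_types, lifting))

lemmas computes_0 = computes_nth[where i = 0]
  and computes_1 = computes_nth[where i = 1]
  and computes_2 = computes_nth[where i = 2]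

lemma computes_comp:
  assumes "recursive f" "computes A g"
  shows "computes A (\<lambda>c. f (g c))"
proof -
  from assms obtain p q where p: "rec_eval p [x] (f x)" and q: "rec_eval q (A c) (g c)" for x c
    unfolding computes_def by blast
  have "rec_eval (Comp p [q]) (A c) (f (g c))" for c
    by (rule rec_eval.Comp[where ys = "[g c]"]) (simp_all add: p q)
  then show ?thesis unfolding computes_def by blast
qed

lemma computes_comp2:
  assumes "recursive2 f" "computes A g" "computes A h"
  shows "computes A (\<lambda>c. f (g c) (h c))"
proof -
  from assms obtain p q r where p: "rec_eval p [fst z, snd z] (f (fst z) (snd z))"
    and q: "rec_eval q (A c) (g c)"
    and r: "rec_eval r (A c) (h c)" for z c
    unfolding computes_def by blast
  have "rec_eval (Comp p [q, r]) (A c) (f (g c) (h c))" for c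
    using p[of "(g c, h c)"] by (intro rec_eval.Comp[where ys = "[g c, h c]"]) (simp_all add: q r)
  then show ?thesis unfolding computes_def by blast
qed

text \<open>\<open>Prim_Rec_Suc\<close> hands the step program the counter, the previous value and
  the parameters, in this order; the context of the second premise is the corresponding
  triple.\<close>

lemma computes_rec_nat:
  assumes "computes A a"
    and "computes (\<lambda>c. fst c # fst (snd c) # A (snd (snd c)))
      (\<lambda>c. h (snd (snd c)) (fst c) (fst (snd c)))"
  shows "computes (\<lambda>c. fst c # A (snd c)) (\<lambda>c. rec_nat (a (snd c)) (h (snd c)) (fst c))"
proof -
  from assms obtain p q where p: "rec_eval p (A c) (a c)"
    and q': "rec_eval q (fst z # fst (snd z) # A (snd (snd z)))
      (h (snd (snd z)) (fst z) (fst (snd z)))" for z c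
    unfolding computes_def by blast
  have q: "rec_eval q (n # y # A c) (h c n y)" for n y c
    using q'[of "(n, y, c)"] by simp
  have "rec_eval (Prim_Rec p q) (n # A c) (rec_nat (a c) (h c) n)" for n c
    by (induction n) (auto intro: rec_eval.intros p q)
  then show ?thesis unfolding computes_def by blast
qed

text \<open>\<open>computes\<close> speaks of total functions only, so \<open>Minimize\<close> is
  available just where the search succeeds in every context. Some searches below therefore carry an
  extra disjunct that ends them in degenerate cases.\<close>

lemma computes_Least:
  assumes "computes (\<lambda>c. fst c # A (snd c)) (\<lambda>c. f (snd c) (fst c))" and "\<And>c. \<exists>n. f c n = 0"
  shows "computes A (\<lambda>c. LEAST n. f c n = 0)"
proof -
  from assms(1) obtain p where p': "rec_eval p (fst z # A (snd z)) (f (snd z) (fst z))" for z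
    unfolding computes_def by blast
  have p: "rec_eval p (n # A c) (f c n)" for n c
    using p'[of "(n, c)"] by simp
  have "rec_eval (Minimize p) (A c) (LEAST n. f c n = 0)" for c
  proof (rule rec_eval.Minimize)
    show "rec_eval p ((LEAST n. f c n = 0) # A c) 0"
      using p LeastI_ex[OF assms(2)] by metis
    show "\<exists>y. rec_eval p (m # A c) (Suc y)" if "m < (LEAST n. f c n = 0)" for m
      using p not_less_Least[OF that] by (metis not0_implies_Suc)
  qed
  then show ?thesis unfolding computes_def by blast
qed

lemma recursive_id: "recursive (\<lambda>x. x)"
  by (rule computes_0) auto

lemma recursive_Suc: "recursive Suc"
  unfolding computes_def by (blast intro: rec_eval.Succ)

lemma computes_const: "computes A (\<lambda>_. k)"
proof (induction k)
  case 0
  then show ?case unfolding computes_def by (blast intro: rec_eval.Zero)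
next
  case (Suc k)
  then show ?case by (rule computes_comp[OF recursive_Suc])
qed

lemma recursive2_rec_nat:
  assumes "recursive a"
    and "computes (\<lambda>c. [fst c, fst (snd c), snd (snd c)]) (\<lambda>c. h (snd (snd c)) (fst c) (fst (snd c)))"
  shows "recursive2 (\<lambda>n x. rec_nat (a x) (h x) n)"
  using computes_rec_nat[where A = "\<lambda>x. [x]", OF assms] .

lemma recursive_rec_nat:
  assumes "recursive2 h"
  shows "recursive (rec_nat k h)"
proof -
  \<comment> \<open>A recursion without parameters runs over the empty parameter list, and its
    context is a single point.\<close>
  have "computes (\<lambda>_::unit. []) (\<lambda>_. k)"
    by (rule computes_const)
  moreover have "computes (\<lambda>c::nat \<times> nat \<times> unit. fst c # fst (snd c) # []) (\<lambda>c. h (fst c) (fst (snd c)))"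
    by (rule computes_comp2[OF assms computes_0 computes_1]) auto
  ultimately have "computes (\<lambda>c::nat \<times> unit. [fst c]) (\<lambda>c. rec_nat k h (fst c))"
    by (rule computes_rec_nat[where A = "\<lambda>_. []"])
  then show ?thesis by (auto simp: computes_def)
qed

lemma recursive2_flip: "recursive2 f \<Longrightarrow> recursive2 (\<lambda>x y. f y x)"
  by (rule computes_comp2[OF _ computes_1 computes_0]) auto

section \<open>Arithmetic\<close>

lemma recursive2_add: "recursive2 (+)"
proof -
  have "recursive2 (\<lambda>n x. rec_nat x (\<lambda>m y. Suc y) n)"
    by (rule recursive2_rec_nat) (rule recursive_id computes_comp[OF recursive_Suc] | (rule computes_1; force))+
  moreover have "rec_nat x (\<lambda>m. Suc) n = n + x" for n x by (induction n) auto
  ultimately show ?thesis by simp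
qed

lemma recursive2_mult: "recursive2 (*)"
proof -
  have "recursive2 (\<lambda>n x. rec_nat 0 (\<lambda>m y. x + y) n)"
    by (rule recursive2_rec_nat[where a = "\<lambda>_. 0", OF computes_const])
      (rule computes_comp2[OF recursive2_add computes_2 computes_1]; force)
  moreover have "rec_nat 0 (\<lambda>m. (+) x) n = n * x" for n x by (induction n) auto
  ultimately show ?thesis by simp
qed

lemma recursive2_power: "recursive2 (^)"
proof -
  have "recursive2 (\<lambda>n x. rec_nat (Suc 0) (\<lambda>m y. x * y) n)"
    by (rule recursive2_rec_nat[where a = "\<lambda>_. Suc 0", OF computes_const])
      (rule computes_comp2[OF recursive2_mult computes_2 computes_1]; force)
  moreover have "rec_nat (Suc 0) (\<lambda>m. (*) x) n = x ^ n" for n x by (induction n) auto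
  ultimately have "recursive2 (\<lambda>n x. x ^ n)" by simp
  then show ?thesis by (rule recursive2_flip)
qed

lemma recursive_pred: "recursive (\<lambda>x. x - 1)"
proof -
  have "recursive (rec_nat 0 (\<lambda>m y. m))"
    by (rule recursive_rec_nat) (rule computes_0; simp)
  moreover have "rec_nat 0 (\<lambda>m y. m) = (\<lambda>x. x - 1)"
  proof
    show "rec_nat 0 (\<lambda>m y. m) n = n - 1" for n by (cases n) auto
  qed
  ultimately show ?thesis by (simp only:)
qed

lemma recursive2_diff: "recursive2 (-)"
proof -
  have "recursive2 (\<lambda>n x. rec_nat x (\<lambda>m y. y - 1) n)"
    by (rule recursive2_rec_nat) (rule recursive_id computes_comp[OF recursive_pred] | (rule computes_1; force))+
  moreover have "rec_nat x (\<lambda>m y. y - 1) n = x - n" for n x by (induction n) auto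
  ultimately have "recursive2 (\<lambda>n x. x - n)" by simp
  then show ?thesis by (rule recursive2_flip)
qed

lemma recursive_triangle: "recursive triangle"
proof -
  have "recursive (rec_nat 0 (\<lambda>m y. y + Suc m))"
    by (rule recursive_rec_nat)
      (rule computes_comp2[OF recursive2_add computes_1 computes_comp[OF recursive_Suc computes_0]]; simp)
  moreover have "rec_nat 0 (\<lambda>m y. y + Suc m) = triangle"
  proof
    show "rec_nat 0 (\<lambda>m y. y + Suc m) n = triangle n" for n by (induction n) auto
  qed
  ultimately show ?thesis by (simp only:)
qed

section \<open>Inverting the pairing function\<close>

definition pfst :: "nat \<Rightarrow> nat" where "pfst z = fst (prod_decode z)"
definition psnd :: "nat \<Rightarrow> nat" where "psnd z = snd (prod_decode z)"

lemma pfst_prod_encode [simp]: "pfst (prod_encode (x, y)) = x"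
  and psnd_prod_encode [simp]: "psnd (prod_encode (x, y)) = y"
  by (simp_all add: pfst_def psnd_def)

lemma prod_encode_pfst_psnd [simp]: "prod_encode (pfst z, psnd z) = z"
  by (simp add: pfst_def psnd_def)

lemma recursive2_prod_encode: "recursive2 (\<lambda>x y. prod_encode (x, y))"
  unfolding prod_encode_def prod.case
  by (rule computes_comp2[OF recursive2_add] computes_comp[OF recursive_triangle])+
    (rule computes_0 computes_1; force)+

text \<open>If \<open>z = prod_encode (x, y)\<close>, then \<open>x + y\<close> is the largest \<open>s\<close> with \<open>triangle s \<le> z\<close>.\<close>

lemma pfst_eq: "pfst z = z - triangle (LEAST s. Suc z - triangle (Suc s) = 0)"
  and psnd_eq: "psnd z = (LEAST s. Suc z - triangle (Suc s) = 0) - pfst z"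
proof -
  obtain x y where z: "z = prod_encode (x, y)" by (metis prod_encode_pfst_psnd)
  have mono: "triangle m \<le> triangle n" if "m \<le> n" for m n
    by (rule lift_Suc_mono_le[of triangle, OF _ that]) simp
  \<comment> \<open>Truncated subtraction turns \<open>z < triangle (Suc s)\<close> into an equation
    with \<open>0\<close>, the form in which minimization searches.\<close>
  have "(LEAST s. Suc z - triangle (Suc s) = 0) = x + y"
  proof (rule Least_equality)
    show "Suc z - triangle (Suc (x + y)) = 0" by (simp add: z prod_encode_def)
    show "x + y \<le> s" if "Suc z - triangle (Suc s) = 0" for s
    proof (rule ccontr)
      assume "\<not> x + y \<le> s"
      then have "triangle (Suc s) \<le> triangle (x + y)" by (intro mono) simp
      with that show False by (simp add: z prod_encode_def)
    qed
  qed
  then show "pfst z = z - triangle (LEAST s. Suc z - triangle (Suc s) = 0)"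
    and "psnd z = (LEAST s. Suc z - triangle (Suc s) = 0) - pfst z"
    by (simp_all add: z) (simp add: prod_encode_def)
qed

lemma recursive_root: "recursive (\<lambda>z. LEAST s. Suc z - triangle (Suc s) = 0)"
proof (rule computes_Least)
  show "recursive2 (\<lambda>s z. Suc z - triangle (Suc s))"
    by (rule computes_comp2[OF recursive2_diff] computes_comp[OF recursive_triangle]
      computes_comp[OF recursive_Suc] | (rule computes_0 computes_1; force))+
  show "\<exists>s. Suc z - triangle (Suc s) = 0" for z
    by (rule exI[of _ z]) simp
qed

lemma recursive_pfst: "recursive pfst"
  unfolding pfst_eq[abs_def]
  by (rule computes_comp2[OF recursive2_diff] computes_comp[OF recursive_triangle]
      recursive_root recursive_id)+

lemma recursive_psnd: "recursive psnd"
  unfolding psnd_eq[abs_def]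
  by (rule computes_comp2[OF recursive2_diff] recursive_root recursive_pfst)+

text \<open>
  From here on a context of several numbers is one number, by iterated pairing: a bound variable
  \<open>y\<close> over the context \<open>c\<close> turns the context into \<open>prod_encode (c, y)\<close>.
\<close>

definition decidable :: "(nat \<Rightarrow> bool) \<Rightarrow> bool" where
  "decidable P \<longleftrightarrow> recursive (\<lambda>x. of_bool (P x))"

text \<open>Closure is often easier to show with both arguments read off one pair; this rule then
  substitutes arbitrary arguments for the two components.\<close>

lemma recursive_comp2:
  assumes "recursive (\<lambda>z. f (pfst z) (psnd z))" "recursive g" "recursive h"
  shows "recursive (\<lambda>x. f (g x) (h x))"
  using computes_comp[OF assms(1) computes_comp2[OF recursive2_prod_encode assms(2,3)]] by simp

lemma decidable_comp2:
  assumes "decidable (\<lambda>z. P (pfst z) (psnd z))" "recursive g" "recursive h"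
  shows "decidable (\<lambda>x. P (g x) (h x))"
  using recursive_comp2[of "\<lambda>x y. of_bool (P x y)", OF _ assms(2,3)] assms(1)
  by (simp add: decidable_def)

lemma recursive_rec_nat_ctx:
  assumes "recursive a" and h: "recursive (\<lambda>z. h (pfst (pfst z)) (psnd (pfst z)) (psnd z))"
    and "recursive b"
  shows "recursive (\<lambda>c. rec_nat (a c) (h c) (b c))"
proof -
  let ?A = "\<lambda>c. [fst c, fst (snd c), snd (snd c)]"
  \<comment> \<open>Repacks the argument list (counter, value, context) as one number in the order
    context, counter, value that \<open>h\<close> expects.\<close>
  have "computes ?A (\<lambda>c. prod_encode (prod_encode (snd (snd c), fst c), fst (snd c)))"
    by (rule computes_comp2[OF recursive2_prod_encode] | (rule computes_0 computes_1 computes_2; force))+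
  from computes_comp[OF h this]
  have "computes ?A (\<lambda>c. h (snd (snd c)) (fst c) (fst (snd c)))" by simp
  from recursive2_rec_nat[OF assms(1) this]
  have "recursive2 (\<lambda>n c. rec_nat (a c) (h c) n)" .
  from computes_comp2[OF this assms(3) recursive_id] show ?thesis .
qed

lemmas recursive_add = computes_comp2[OF recursive2_add, where A = "\<lambda>x. [x]"]
  and recursive_mult = computes_comp2[OF recursive2_mult, where A = "\<lambda>x. [x]"]
  and recursive_diff = computes_comp2[OF recursive2_diff, where A = "\<lambda>x. [x]"]
  and recursive_power = computes_comp2[OF recursive2_power, where A = "\<lambda>x. [x]"]
  and recursive_pair = computes_comp2[OF recursive2_prod_encode, where A = "\<lambda>x. [x]"]
  and recursive_fst = computes_comp[OF recursive_pfst, where A = "\<lambda>x. [x]"]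
  and recursive_snd = computes_comp[OF recursive_psnd, where A = "\<lambda>x. [x]"]
  and recursive_suc = computes_comp[OF recursive_Suc, where A = "\<lambda>x. [x]"]
  and recursive_const = computes_const[where A = "\<lambda>x. [x]"]

lemmas recursive_base = recursive_id recursive_const recursive_add recursive_mult recursive_diff
  recursive_power recursive_pair recursive_fst recursive_snd recursive_suc

section \<open>Decidable predicates, case distinction and search\<close>

lemma decidable_eq_0: "recursive f \<Longrightarrow> decidable (\<lambda>x. f x = 0)"
proof -
  assume "recursive f"
  then have "recursive (\<lambda>x. 1 - f x)" by (intro recursive_base)
  moreover have "(\<lambda>x. 1 - f x) = (\<lambda>x. of_bool (f x = 0))" by (auto simp: fun_eq_iff)
  ultimately show ?thesis by (simp only: decidable_def)
qed

lemma decidable_not: "decidable P \<Longrightarrow> decidable (\<lambda>x. \<not> P x)"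
  using decidable_eq_0[of "\<lambda>x. of_bool (P x)"] by (simp add: decidable_def)

lemma decidable_conj: "decidable P \<Longrightarrow> decidable Q \<Longrightarrow> decidable (\<lambda>x. P x \<and> Q x)"
  unfolding decidable_def of_bool_conj by (intro recursive_base)

lemma decidable_disj: "decidable P \<Longrightarrow> decidable Q \<Longrightarrow> decidable (\<lambda>x. P x \<or> Q x)"
  using decidable_not[OF decidable_conj[OF decidable_not decidable_not]] by simp

lemma decidable_imp: "decidable P \<Longrightarrow> decidable Q \<Longrightarrow> decidable (\<lambda>x. P x \<longrightarrow> Q x)"
  unfolding imp_conv_disj by (intro decidable_disj decidable_not)

lemma decidable_le: "recursive f \<Longrightarrow> recursive g \<Longrightarrow> decidable (\<lambda>x. f x \<le> g x)"
  using decidable_eq_0[OF recursive_diff] by simp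

lemma decidable_less: "recursive f \<Longrightarrow> recursive g \<Longrightarrow> decidable (\<lambda>x. f x < g x)"
  unfolding not_le[symmetric] by (intro decidable_not decidable_le)

lemma decidable_eq: "recursive f \<Longrightarrow> recursive g \<Longrightarrow> decidable (\<lambda>x. f x = g x)"
  unfolding order_eq_iff by (intro decidable_conj decidable_le)

lemma recursive_if:
  assumes "decidable P" "recursive f" "recursive g"
  shows "recursive (\<lambda>x. if P x then f x else g x)"
proof -
  have "recursive (\<lambda>x. of_bool (P x) * f x + (1 - of_bool (P x)) * g x)"
    using assms unfolding decidable_def by (intro recursive_base)
  moreover have "(\<lambda>x. of_bool (P x) * f x + (1 - of_bool (P x)) * g x) =
      (\<lambda>x. if P x then f x else g x)" by auto
  ultimately show ?thesis by (simp only:)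
qed

lemma recursive_Least:
  assumes "decidable (\<lambda>z. P (pfst z) (psnd z))" and "\<And>c. \<exists>n. P c n"
  shows "recursive (\<lambda>c. LEAST n. P c n)"
proof -
  have "recursive (\<lambda>z. 1 - of_bool (P (pfst z) (psnd z)) :: nat)"
    using assms(1) unfolding decidable_def by (intro recursive_base)
  \<comment> \<open>\<open>Minimize\<close> puts the searched number first, whereas the pairing
    convention puts a bound variable last.\<close>
  moreover have "recursive2 (\<lambda>n c. prod_encode (c, n))"
    by (rule computes_comp2[OF recursive2_prod_encode computes_1 computes_0]) simp_all
  ultimately have "recursive2 (\<lambda>n c. 1 - of_bool (P c n))"
    using computes_comp[where A = "\<lambda>c. [fst c, snd c]"] by fastforce
  from computes_Least[where A = "\<lambda>x. [x]" and f = "\<lambda>c n. 1 - of_bool (P c n)"] this assms(2)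
  have "recursive (\<lambda>c. LEAST n. 1 - of_bool (P c n) = (0 :: nat))" by simp
  moreover have "1 - of_bool b = (0 :: nat) \<longleftrightarrow> b" for b by (cases b) simp_all
  ultimately show ?thesis by (simp only:)
qed

lemma decidable_bex_less:
  assumes "decidable (\<lambda>z. P (pfst z) (psnd z))" "recursive b"
  shows "decidable (\<lambda>c. \<exists>y<b c. P c y)"
proof -
  have "recursive (\<lambda>z. if P (pfst (pfst z)) (psnd (pfst z)) then 1 else psnd z)"
    by (intro recursive_if recursive_base decidable_comp2[OF assms(1)])
  then have "recursive (\<lambda>c. rec_nat 0 (\<lambda>n y. if P c n then 1 else y) (b c))"
    by (intro recursive_rec_nat_ctx recursive_const assms(2))
  moreover have "rec_nat 0 (\<lambda>n y. if P c n then 1 else y) m = (of_bool (\<exists>y<m. P c y) :: nat)" for c m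
    by (induction m) (auto simp: less_Suc_eq)
  ultimately show ?thesis by (simp add: decidable_def)
qed

lemma decidable_ball_less:
  assumes "decidable (\<lambda>z. P (pfst z) (psnd z))" "recursive b"
  shows "decidable (\<lambda>c. \<forall>y<b c. P c y)"
  using decidable_not[OF decidable_bex_less[OF decidable_not[OF assms(1)] assms(2)]] by simp

section \<open>Division and finite sets coded in binary\<close>

lemma recursive_div:
  assumes "recursive f" "recursive g"
  shows "recursive (\<lambda>x. f x div g x)"
proof (rule recursive_comp2[OF _ assms])
  \<comment> \<open>The quotient is the least \<open>q\<close> with \<open>m < n * Suc q\<close>.
    For \<open>n = 0\<close> there is none; the first disjunct then stops the search at
    \<open>0\<close>, which is the value of \<open>m div 0\<close>.\<close>
  have "recursive (\<lambda>z. LEAST q. psnd z = 0 \<or> pfst z < psnd z * Suc q)"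
  proof (rule recursive_Least)
    show "decidable (\<lambda>z. psnd (pfst z) = 0 \<or> pfst (pfst z) < psnd (pfst z) * Suc (psnd z))"
      by (intro decidable_disj decidable_eq decidable_less recursive_base)
    show "\<exists>q. psnd z = 0 \<or> pfst z < psnd z * Suc q" for z
      by (rule exI[of _ "pfst z"]) (cases "psnd z"; simp)
  qed
  moreover have "(LEAST q. n = 0 \<or> m < n * Suc q) = m div n" for m n :: nat
  proof (cases "n = 0")
    case False
    then show ?thesis
      by (intro Least_equality)
        (auto simp: dividend_less_times_div mult.commute less_mult_imp_div_less simp flip: less_Suc_eq_le)
  qed simp
  ultimately show "recursive (\<lambda>z. pfst z div psnd z)" by simp
qed

text \<open>Membership of \<open>m\<close> in the set coded by \<open>n\<close> means that the
  binary digit \<open>m\<close> of \<open>n\<close> is \<open>1\<close>, that is,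
  \<open>n div 2 ^ m\<close> is odd; oddness is tested by halving and doubling.\<close>

lemma decidable_mem:
  assumes "recursive f" "recursive g"
  shows "decidable (\<lambda>x. f x \<in> set_decode (g x))"
proof -
  have "decidable (\<lambda>x. \<not> g x div 2 ^ f x = 2 * (g x div 2 ^ f x div 2))"
    by (intro decidable_not decidable_eq recursive_base recursive_div assms)
  moreover have "m \<in> set_decode n \<longleftrightarrow> \<not> n div 2 ^ m = 2 * (n div 2 ^ m div 2)" for m n
    unfolding set_decode_def by (auto elim: oddE) (metis dvd_triv_left)
  ultimately show ?thesis by simp
qed

text \<open>A member \<open>x\<close> contributes \<open>2 ^ x\<close> to the code, and this power
  exceeds \<open>x\<close>. The code of a set thus bounds its members, which turns quantifiers and
  recursions over the set into bounded ones.\<close>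

lemma set_decode_less: "x \<in> set_decode s \<Longrightarrow> x < s"
proof -
  assume "x \<in> set_decode s"
  then have "s div 2 ^ x \<noteq> 0" by (auto simp: set_decode_def intro: ccontr)
  then have "2 ^ x \<le> s" by (metis div_less not_le)
  then show ?thesis using less_exp[of x] by linarith
qed

lemma set_encode_eq_iff: "finite A \<Longrightarrow> finite B \<Longrightarrow> set_encode A = set_encode B \<longleftrightarrow> A = B"
  by (metis set_encode_inverse)

lemma decidable_bex_set:
  assumes "decidable (\<lambda>z. P (pfst z) (psnd z))" "recursive s"
  shows "decidable (\<lambda>c. \<exists>y\<in>set_decode (s c). P c y)"
proof -
  have "decidable (\<lambda>c. \<exists>y<s c. y \<in> set_decode (s c) \<and> P c y)"
    by (intro decidable_bex_less decidable_conj decidable_mem recursive_base assms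
        computes_comp[OF assms(2)])
  moreover have "(\<lambda>c. \<exists>y<s c. y \<in> set_decode (s c) \<and> P c y) = (\<lambda>c. \<exists>y\<in>set_decode (s c). P c y)"
    by (auto dest: set_decode_less)
  ultimately show ?thesis by simp
qed

lemma decidable_ball_set:
  assumes "decidable (\<lambda>z. P (pfst z) (psnd z))" "recursive s"
  shows "decidable (\<lambda>c. \<forall>y\<in>set_decode (s c). P c y)"
  using decidable_not[OF decidable_bex_set[OF decidable_not[OF assms(1)] assms(2)]] by simp

lemma recursive_insert:
  assumes "recursive f" "recursive s"
  shows "recursive (\<lambda>c. set_encode (insert (f c) (set_decode (s c))))"
proof -
  have "recursive (\<lambda>c. if f c \<in> set_decode (s c) then s c else 2 ^ f c + s c)"
    by (intro recursive_if decidable_mem recursive_base assms)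
  moreover have "set_encode (insert x (set_decode n)) = (if x \<in> set_decode n then n else 2 ^ x + n)"
    for x n by (auto simp: insert_absorb set_encode_insert)
  ultimately show ?thesis by simp
qed

text \<open>A recursion up to the code \<open>s c\<close> meets every member by
  \<open>set_decode_less\<close>; its value is the code of the images collected so far. Unions are
  collected in the same way below.\<close>

lemma recursive_image_filter:
  assumes "recursive (\<lambda>z. h (pfst z) (psnd z))" "recursive s" "decidable (\<lambda>z. P (pfst z) (psnd z))"
  shows "recursive (\<lambda>c. set_encode (h c ` {y \<in> set_decode (s c). P c y}))"
proof -
  let ?g = "\<lambda>c n y. if n \<in> set_decode (s c) \<and> P c n then set_encode (insert (h c n) (set_decode y)) else y"
  have "recursive (\<lambda>c. rec_nat 0 (?g c) (s c))"
    by (intro recursive_rec_nat_ctx recursive_if decidable_conj decidable_mem recursive_insert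
        recursive_base assms recursive_comp2[OF assms(1)] decidable_comp2[OF assms(3)]
        computes_comp[OF assms(2)])
  moreover have "rec_nat 0 (?g c) m = set_encode (h c ` {y \<in> set_decode (s c). P c y \<and> y < m})" for c m
  proof (induction m)
    case (Suc m)
    have "{y \<in> set_decode (s c). P c y \<and> y < Suc m} =
      (if m \<in> set_decode (s c) \<and> P c m then insert m else id) {y \<in> set_decode (s c). P c y \<and> y < m}"
      by (auto simp: less_Suc_eq)
    with Suc show ?case by simp
  qed simp
  moreover have "{y \<in> set_decode (s c). P c y \<and> y < s c} = {y \<in> set_decode (s c). P c y}" for c
    by (auto dest: set_decode_less)
  ultimately show ?thesis by simp
qed

lemma recursive_image:
  assumes "recursive (\<lambda>z. h (pfst z) (psnd z))" "recursive s"
  shows "recursive (\<lambda>c. set_encode (h c ` set_decode (s c)))"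
  using recursive_image_filter[where P = "\<lambda>_ _. True", OF assms] decidable_eq[OF recursive_id recursive_id]
  by simp

lemma recursive_Un:
  assumes "recursive s" "recursive t"
  shows "recursive (\<lambda>c. set_encode (set_decode (s c) \<union> set_decode (t c)))"
proof -
  let ?g = "\<lambda>c n y. if n \<in> set_decode (t c) then set_encode (insert n (set_decode y)) else y"
  have "recursive (\<lambda>c. rec_nat (s c) (?g c) (t c))"
    by (intro recursive_rec_nat_ctx recursive_if decidable_mem recursive_insert
        recursive_base assms computes_comp[OF assms(2)])
  moreover have "rec_nat (s c) (?g c) m = set_encode (set_decode (s c) \<union> {y \<in> set_decode (t c). y < m})" for c m
  proof (induction m)
    case (Suc m)
    have "set_decode (s c) \<union> {y \<in> set_decode (t c). y < Suc m} =
      (if m \<in> set_decode (t c) then insert m else id) (set_decode (s c) \<union> {y \<in> set_decode (t c). y < m})"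
      by (auto simp: less_Suc_eq)
    with Suc show ?case by simp
  qed simp
  moreover have "{y \<in> set_decode (t c). y < t c} = set_decode (t c)" for c
    by (auto dest: set_decode_less)
  ultimately show ?thesis by simp
qed

lemma recursive_UN:
  assumes "recursive (\<lambda>z. h (pfst z) (psnd z))" "recursive s"
  shows "recursive (\<lambda>c. set_encode (\<Union>y\<in>set_decode (s c). set_decode (h c y)))"
proof -
  let ?g = "\<lambda>c n y. if n \<in> set_decode (s c) then set_encode (set_decode y \<union> set_decode (h c n)) else y"
  have "recursive (\<lambda>c. rec_nat 0 (?g c) (s c))"
    by (intro recursive_rec_nat_ctx recursive_if decidable_mem recursive_Un
        recursive_base assms recursive_comp2[OF assms(1)] computes_comp[OF assms(2)])
  moreover have "rec_nat 0 (?g c) m = set_encode (\<Union>y\<in>{y \<in> set_decode (s c). y < m}. set_decode (h c y))" for c m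
  proof (induction m)
    case (Suc m)
    have "{y \<in> set_decode (s c). y < Suc m} =
      (if m \<in> set_decode (s c) then insert m else id) {y \<in> set_decode (s c). y < m}"
      by (auto simp: less_Suc_eq)
    with Suc show ?case by (simp add: Un_commute)
  qed simp
  moreover have "{y \<in> set_decode (s c). y < s c} = set_decode (s c)" for c
    by (auto dest: set_decode_less)
  ultimately show ?thesis by simp
qed

section \<open>Codes of databases\<close>

text \<open>Undoes \<open>list_encode (x # xs) = Suc (prod_encode (x, list_encode xs))\<close>
  \<open>i\<close> times. Past the end it stays at \<open>0\<close>, the code of \<open>[]\<close>,
  because \<open>psnd 0 = 0\<close>.\<close>

definition drop_code :: "nat \<Rightarrow> nat \<Rightarrow> nat" where
  "drop_code i l = rec_nat l (\<lambda>_ y. psnd (y - 1)) i"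

definition nth_code :: "nat \<Rightarrow> nat \<Rightarrow> nat" where
  "nth_code i l = pfst (drop_code i l - 1)"

text \<open>The code of a list is at least its length, so \<open>l\<close> bounds the indices;
  \<open>drop_code i l \<noteq> 0\<close> says that \<open>i\<close> is an index of the
  list.\<close>

definition mem_code :: "nat \<Rightarrow> nat \<Rightarrow> bool" where
  "mem_code x l \<longleftrightarrow> (\<exists>i<l. drop_code i l \<noteq> 0 \<and> nth_code i l = x)"

text \<open>Lists are equally long if the same drops exhaust them. The bound has to admit both
  lengths themselves, the first indices at which the drops are empty.\<close>

definition same_length_code :: "nat \<Rightarrow> nat \<Rightarrow> bool" where
  "same_length_code l m \<longleftrightarrow> (\<forall>i<Suc (l + m). drop_code i l = 0 \<longleftrightarrow> drop_code i m = 0)"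

text \<open>The disjunct \<open>F \<le> y\<close> only makes the search terminate outside the domain.\<close>

definition apply_code :: "nat \<Rightarrow> nat \<Rightarrow> nat" where
  "apply_code F x = (LEAST y. F \<le> y \<or> prod_encode (x, y) \<in> set_decode F)"

lemma drop_code_list_encode [simp]: "drop_code i (list_encode xs) = list_encode (drop i xs)"
proof (induction i)
  case (Suc i)
  then have "drop_code (Suc i) (list_encode xs) = psnd (list_encode (drop i xs) - 1)"
    by (simp add: drop_code_def)
  also have "\<dots> = list_encode (drop 1 (drop i xs))"
  proof (cases "drop i xs")
    case Nil
    have "psnd 0 = 0" by (metis prod_encode_pfst_psnd le_prod_encode_2 le_zero_eq)
    with Nil show ?thesis by simp
  qed simp
  finally show ?case by simp
qed (simp add: drop_code_def)

lemma nth_code_list_encode [simp]: "i < length xs \<Longrightarrow> nth_code i (list_encode xs) = xs ! i"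
  by (simp add: nth_code_def flip: Cons_nth_drop_Suc)

lemma list_encode_eq_0_iff [simp]: "list_encode xs = 0 \<longleftrightarrow> xs = []"
  by (cases xs) auto

lemma length_le_list_encode: "length xs \<le> list_encode xs"
  by (induction xs) (auto intro: order.trans le_prod_encode_2)

lemma mem_code_list_encode: "mem_code x (list_encode xs) \<longleftrightarrow> x \<in> set xs"
proof -
  have "mem_code x (list_encode xs) \<longleftrightarrow> (\<exists>i<list_encode xs. i < length xs \<and> xs ! i = x)"
    unfolding mem_code_def
    by (intro ex_cong conj_cong refl) (simp_all add: not_le)
  also have "\<dots> \<longleftrightarrow> (\<exists>i<length xs. xs ! i = x)"
    using length_le_list_encode[of xs] by (blast intro: less_le_trans)
  finally show ?thesis by (simp add: in_set_conv_nth)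
qed

lemma same_length_code_list_encode:
  "same_length_code (list_encode xs) (list_encode ys) \<longleftrightarrow> length xs = length ys"
proof
  assume *: "same_length_code (list_encode xs) (list_encode ys)"
  have "length xs < Suc (list_encode xs + list_encode ys)" "length ys < Suc (list_encode xs + list_encode ys)"
    using length_le_list_encode[of xs] length_le_list_encode[of ys] by linarith+
  with * have "length xs \<le> length xs \<longleftrightarrow> length ys \<le> length xs"
    and "length xs \<le> length ys \<longleftrightarrow> length ys \<le> length ys"
    unfolding same_length_code_def drop_code_list_encode list_encode_eq_0_iff drop_eq_Nil by blast+
  then show "length xs = length ys" by simp
qed (simp add: same_length_code_def)

lemma set_decode_enc_set [simp]: "finite A \<Longrightarrow> set_decode (enc_set e A) = e ` A"
  by (simp add: enc_set_def)

text \<open>The value is a component of a pair in the coded set, so it lies below the code; the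
  search finds it before the terminating disjunct becomes true.\<close>

lemma apply_code_enc_fun:
  assumes "finite X" "x \<in> X"
  shows "apply_code (enc_fun X id e f) x = e (f x)"
  unfolding apply_code_def
proof (rule Least_equality)
  let ?F = "enc_fun X id e f"
  have F: "set_decode ?F = (\<lambda>x. prod_encode (x, e (f x))) ` X"
    using assms(1) by (simp add: enc_fun_def image_image enc_pair_def)
  then have mem: "prod_encode (x, y) \<in> set_decode ?F \<longleftrightarrow> y = e (f x)" for y
    using assms(2) by auto
  then show "?F \<le> e (f x) \<or> prod_encode (x, e (f x)) \<in> set_decode ?F"
    by simp
  have "e (f x) < ?F"
    using set_decode_less[of "prod_encode (x, e (f x))" ?F] mem le_prod_encode_2[of "e (f x)" x]
    by simp
  then show "e (f x) \<le> y" if "?F \<le> y \<or> prod_encode (x, y) \<in> set_decode ?F" for y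
    using that mem by auto
qed

section \<open>Recursiveness of access to lists and functions\<close>

lemma recursive_drop_code:
  assumes "recursive f" "recursive g"
  shows "recursive (\<lambda>x. drop_code (f x) (g x))"
  unfolding drop_code_def by (intro recursive_rec_nat_ctx recursive_base assms)

lemma recursive_nth_code:
  "recursive f \<Longrightarrow> recursive g \<Longrightarrow> recursive (\<lambda>x. nth_code (f x) (g x))"
  unfolding nth_code_def by (intro recursive_drop_code recursive_base)

lemma decidable_iff:
  "decidable P \<Longrightarrow> decidable Q \<Longrightarrow> decidable (\<lambda>x. P x \<longleftrightarrow> Q x)"
  unfolding iff_conv_conj_imp by (intro decidable_conj decidable_imp)

lemma decidable_mem_code:
  assumes "recursive f" "recursive g"
  shows "decidable (\<lambda>x. mem_code (f x) (g x))"
proof (rule decidable_comp2[OF _ assms])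
  show "decidable (\<lambda>z. mem_code (pfst z) (psnd z))"
    unfolding mem_code_def
    by (intro decidable_bex_less decidable_conj decidable_not decidable_eq recursive_drop_code
        recursive_nth_code recursive_base)
qed

lemma decidable_same_length_code:
  assumes "recursive f" "recursive g"
  shows "decidable (\<lambda>x. same_length_code (f x) (g x))"
proof (rule decidable_comp2[OF _ assms])
  show "decidable (\<lambda>z. same_length_code (pfst z) (psnd z))"
    unfolding same_length_code_def
    by (intro decidable_ball_less decidable_iff decidable_eq recursive_drop_code recursive_base)
qed

lemma recursive_apply_code:
  assumes "recursive f" "recursive g"
  shows "recursive (\<lambda>x. apply_code (f x) (g x))"
proof (rule recursive_comp2[OF _ assms])
  show "recursive (\<lambda>z. apply_code (pfst z) (psnd z))"
    unfolding apply_code_def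
  proof (rule recursive_Least)
    show "decidable (\<lambda>z. pfst (pfst z) \<le> psnd z \<or>
        prod_encode (psnd (pfst z), psnd z) \<in> set_decode (pfst (pfst z)))"
      by (intro decidable_disj decidable_le decidable_mem recursive_base)
    show "\<exists>y. pfst z \<le> y \<or> prod_encode (psnd z, y) \<in> set_decode (pfst z)" for z
      by (rule exI[of _ "pfst z"]) simp
  qed
qed

lemmas recursive_intros =
  recursive_base recursive_nth_code recursive_apply_code recursive_if recursive_image
  recursive_image_filter recursive_Un recursive_UN
lemmas decidable_intros =
  decidable_eq decidable_mem decidable_mem_code decidable_same_length_code decidable_not
  decidable_conj decidable_imp decidable_ball_set decidable_bex_set

text \<open>The indices follow the nesting in \<open>enc_graph_db\<close>. In a schema graph, entry
  0 is the property graph and entries 1 to 3 are \<open>pk\<close>, \<open>fk_source\<close>,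
  \<open>fk_dest\<close>; in a property graph, entries 0 to 4 are vertices, edges, tails, heads and
  vertex labels, and entry 6 holds the vertex properties.\<close>

abbreviation schema_part :: "nat \<Rightarrow> nat \<Rightarrow> nat" where
  "schema_part i x \<equiv> nth_code i (nth_code 0 x)"

abbreviation schema_graph_part :: "nat \<Rightarrow> nat \<Rightarrow> nat" where
  "schema_graph_part i x \<equiv> nth_code i (schema_part 0 x)"

abbreviation instance_part :: "nat \<Rightarrow> nat \<Rightarrow> nat" where
  "instance_part i x \<equiv> nth_code i (nth_code (Suc 0) x)"

abbreviation schema_rel :: "nat \<Rightarrow> nat \<Rightarrow> nat" where
  "schema_rel x v \<equiv> nth_code 0 (apply_code (schema_graph_part 4 x) v)"

abbreviation schema_props :: "nat \<Rightarrow> nat \<Rightarrow> nat" where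
  "schema_props x v \<equiv> apply_code (schema_graph_part 6 x) v"

abbreviation instance_rel :: "nat \<Rightarrow> nat \<Rightarrow> nat" where
  "instance_rel x v \<equiv> nth_code 0 (apply_code (instance_part 4 x) v)"

abbreviation instance_props :: "nat \<Rightarrow> nat \<Rightarrow> nat" where
  "instance_props x v \<equiv> apply_code (instance_part 6 x) v"

definition functional_code :: "nat \<Rightarrow> bool" where
  "functional_code s \<longleftrightarrow> (\<forall>p\<in>set_decode s. \<forall>q\<in>set_decode s. pfst p = pfst q \<longrightarrow> p = q)"

text \<open>\<open>b\<close>, \<open>a\<close> and \<open>n\<close> are the numbers of \<open>tid\<close>, \<open>vid\<close> and \<open>NULL\<close>.\<close>

definition decodable_code :: "nat \<Rightarrow> nat \<Rightarrow> nat \<Rightarrow> nat \<Rightarrow> bool" where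
  "decodable_code b a n x \<longleftrightarrow>
     (\<forall>v\<in>set_decode (schema_graph_part 0 x). \<forall>w\<in>set_decode (schema_graph_part 0 x).
        schema_rel x v = schema_rel x w \<longrightarrow> v = w) \<and>
     (\<forall>v\<in>set_decode (schema_graph_part 0 x).
        functional_code (schema_props x v) \<and>
        prod_encode (a, 2) \<in> set_decode (schema_props x v) \<and>
        \<not> (\<exists>p\<in>set_decode (schema_props x v). pfst p = b) \<and>
        (\<not> apply_code (schema_part (Suc 0) x) v = 0 \<longrightarrow> \<not> mem_code a (apply_code (schema_part (Suc 0) x) v - 1))) \<and>
     (\<forall>e\<in>set_decode (schema_graph_part (Suc 0) x).
        same_length_code (apply_code (schema_part 2 x) e) (apply_code (schema_part 3 x) e) \<and>
        \<not> mem_code a (apply_code (schema_part 2 x) e) \<and>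
        apply_code (schema_part (Suc 0) x) (apply_code (schema_graph_part 3 x) e) =
          Suc (apply_code (schema_part 3 x) e)) \<and>
     (\<forall>v\<in>set_decode (instance_part 0 x).
        functional_code (instance_props x v) \<and>
        \<not> prod_encode (a, n) \<in> set_decode (instance_props x v) \<and>
        (\<forall>w\<in>set_decode (schema_graph_part 0 x). instance_rel x v = schema_rel x w \<longrightarrow>
           set_encode (pfst ` set_decode (instance_props x v)) =
           set_encode (pfst ` set_decode (schema_props x w)))) \<and>
     (\<forall>v\<in>set_decode (instance_part 0 x). \<forall>w\<in>set_decode (instance_part 0 x).
        instance_rel x v = instance_rel x w \<longrightarrow>
        (\<exists>p\<in>set_decode (instance_props x v). pfst p = a \<and> p \<in> set_decode (instance_props x w)) \<longrightarrow>
        v = w)"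

lemma decidable_functional_code:
  assumes "recursive f"
  shows "decidable (\<lambda>x. functional_code (f x))"
proof -
  have "decidable functional_code"
    unfolding functional_code_def[abs_def] by (intro decidable_intros recursive_base)
  then show ?thesis
    using assms unfolding decidable_def by (rule computes_comp)
qed

text \<open>Follows from the syntax of the definition, in which all quantifiers range over coded
  sets and equality of sets is equality of their codes.\<close>

lemma decidable_decodable_code: "decidable (decodable_code b a n)"
  unfolding decodable_code_def[abs_def]
  by (intro decidable_intros decidable_functional_code recursive_intros)

text \<open>Mirrors the nesting of \<open>enc_rel_db\<close>. Each
  \<open>set_decode (set_encode ...)\<close> puts an operand of a union into the form that
  \<open>recursive_Un\<close> and \<open>recursive_UN\<close> expect, and the \<open>- 1\<close>
  behind a primary key removes the \<open>Suc\<close> of \<open>enc_option\<close>.\<close>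

definition decode_code :: "nat \<Rightarrow> nat \<Rightarrow> nat \<Rightarrow> nat" where
  "decode_code b a x = list_encode [
     list_encode [
       set_encode (schema_rel x ` set_decode (schema_graph_part 0 x)),
       set_encode ((\<lambda>v. prod_encode (schema_rel x v,
           set_encode (pfst ` {p \<in> set_decode (schema_props x v). \<not> pfst p = a}))) `
         set_decode (schema_graph_part 0 x)),
       set_encode (\<Union>v\<in>set_decode (schema_graph_part 0 x). set_decode (
         set_encode ((\<lambda>p. prod_encode (prod_encode (schema_rel x v, pfst p), psnd p)) `
           {p \<in> set_decode (schema_props x v). \<not> pfst p = a}))),
       set_encode (
         set_decode (set_encode (
           (\<lambda>v. list_encode [schema_rel x v, apply_code (schema_part (Suc 0) x) v - 1]) `
           {v \<in> set_decode (schema_graph_part 0 x). \<not> apply_code (schema_part (Suc 0) x) v = 0})) \<union>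
         set_decode (set_encode (
           (\<lambda>e. list_encode [
              schema_rel x (apply_code (schema_graph_part 2 x) e), apply_code (schema_part 2 x) e,
              schema_rel x (apply_code (schema_graph_part 3 x) e), apply_code (schema_part 3 x) e]) `
           set_decode (schema_graph_part (Suc 0) x))))],
     set_encode ((\<lambda>v. prod_encode (instance_rel x v,
         set_encode ((\<lambda>p. prod_encode (if pfst p = a then b else pfst p, psnd p)) `
           set_decode (instance_props x v)))) `
       set_decode (instance_part 0 x))]"

lemma recursive_decode_code: "recursive (decode_code b a)"
  unfolding decode_code_def[abs_def] list_encode.simps
  by (intro recursive_intros decidable_intros)

section \<open>Decoding graph databases\<close>

text \<open>Properties form relations, whereas relational databases consist of extensional
  functions. Restricting to the domain makes \<open>fun_of\<close> inverse to taking graphs on both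
  sides.\<close>

definition fun_of :: "('x \<times> 'y) set \<Rightarrow> 'x \<Rightarrow> 'y" where
  "fun_of R = (\<lambda>x\<in>Domain R. THE y. (x, y) \<in> R)"

lemma fun_of_eq: "single_valued R \<Longrightarrow> (x, y) \<in> R \<Longrightarrow> fun_of R x = y"
  unfolding fun_of_def by (auto dest: single_valuedD)

lemma fun_of_PiE:
  assumes "single_valued R" "\<And>x y. (x, y) \<in> R \<Longrightarrow> y \<in> B x" "X = Domain R"
  shows "fun_of R \<in> (\<Pi>\<^sub>E x\<in>X. B x)"
  using assms by (auto simp: fun_of_eq) (simp add: fun_of_def)

lemma Domain_image [simp]: "Domain ((\<lambda>v. (k v, g v)) ` A) = k ` A"
  by (simp add: Domain_fst image_image)

lemma fun_of_graph:
  assumes "f \<in> extensional X"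
  shows "fun_of ((\<lambda>x. (x, f x)) ` X) = f"
proof
  fix x
  show "fun_of ((\<lambda>x. (x, f x)) ` X) x = f x"
    using assms by (auto simp: fun_of_def extensional_def image_iff)
qed

lemma graph_fun_of:
  assumes "single_valued R"
  shows "(\<lambda>x. (x, fun_of R x)) ` Domain R = R"
  using assms by (force simp: fun_of_eq)

lemma single_valued_image: "inj_on k A \<Longrightarrow> single_valued ((\<lambda>v. (k v, g v)) ` A)"
  by (auto simp: single_valued_def inj_on_def)

lemma fun_of_image: "inj_on k A \<Longrightarrow> v \<in> A \<Longrightarrow> fun_of ((\<lambda>v. (k v, g v)) ` A) (k v) = g v"
  by (rule fun_of_eq) (auto simp: single_valued_image)

text \<open>Also defined on \<open>Dash\<close>, because a vertex of an arbitrary graph database may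
  carry such a label. On codes it is the first list entry in both cases.\<close>

primrec source_rel :: "'r label \<Rightarrow> 'r" where
  "source_rel (Name r) = r"
| "source_rel (Dash r s) = r"

abbreviation rel_of :: "('r, 'p, 'm) property_graph_scheme \<Rightarrow> nat \<Rightarrow> 'r" where
  "rel_of G v \<equiv> source_rel (vlabel G v)"

text \<open>
  The edge labels and the instance edges are redundant, so decoding ignores them, and malformed
  ones do no harm.
\<close>

definition decodable_db :: "'a \<Rightarrow> 'a \<Rightarrow> 'd \<Rightarrow> ('r, 'a, 'd) graph_db \<Rightarrow> bool" where
  "decodable_db tid vid null = (\<lambda>(SG, IG).
     inj_on (rel_of SG) (gverts SG) \<and>
     (\<forall>v\<in>gverts SG.
        single_valued (vprops SG v) \<and> (vid, Integer) \<in> vprops SG v \<and> tid \<notin> Domain (vprops SG v) \<and>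
        (\<forall>as. pk SG v = Some as \<longrightarrow> vid \<notin> set as)) \<and>
     (\<forall>e\<in>garcs SG.
        length (fk_source SG e) = length (fk_dest SG e) \<and> vid \<notin> set (fk_source SG e) \<and>
        pk SG (ghead SG e) = Some (fk_dest SG e)) \<and>
     (\<forall>v\<in>gverts IG.
        single_valued (vprops IG v) \<and> (vid, null) \<notin> vprops IG v \<and>
        (\<forall>w\<in>gverts SG. rel_of IG v = rel_of SG w \<longrightarrow> Domain (vprops IG v) = Domain (vprops SG w))) \<and>
     (\<forall>v\<in>gverts IG. \<forall>w\<in>gverts IG.
        rel_of IG v = rel_of IG w \<longrightarrow> (\<exists>c. (vid, c) \<in> vprops IG v \<and> (vid, c) \<in> vprops IG w) \<longrightarrow>
        v = w))"

definition proper_props :: "'a \<Rightarrow> ('a \<times> 'y) set \<Rightarrow> ('a \<times> 'y) set" where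
  "proper_props vid P = {p \<in> P. fst p \<noteq> vid}"

definition tuple_props :: "'a \<Rightarrow> 'a \<Rightarrow> ('a \<times> 'y) set \<Rightarrow> ('a \<times> 'y) set" where
  "tuple_props tid vid P = (\<lambda>(a, c). (if a = vid then tid else a, c)) ` P"

definition decode_schema :: "'a \<Rightarrow> ('r, 'a) schema_graph \<Rightarrow> ('r, 'a) rel_schema" where
  "decode_schema vid SG = \<lparr>
     rels = rel_of SG ` gverts SG,
     attrs = fun_of ((\<lambda>v. (rel_of SG v, Domain (proper_props vid (vprops SG v)))) ` gverts SG),
     attr_type = fun_of ((\<lambda>v. (rel_of SG v, fun_of (proper_props vid (vprops SG v)))) ` gverts SG),
     keys = (\<lambda>v. Primary_Key (rel_of SG v) (the (pk SG v))) ` {v \<in> gverts SG. pk SG v \<noteq> None} \<union>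
       (\<lambda>e. Foreign_Key (rel_of SG (gtail SG e)) (fk_source SG e) (rel_of SG (ghead SG e))
          (fk_dest SG e)) ` garcs SG\<rparr>"

definition decode_tuples ::
  "'a \<Rightarrow> 'a \<Rightarrow> ('r, 'a \<times> 'd) property_graph \<Rightarrow> ('r \<times> ('a \<Rightarrow> 'd)) set" where
  "decode_tuples tid vid IG =
     (\<lambda>v. (rel_of IG v, fun_of (tuple_props tid vid (vprops IG v)))) ` gverts IG"

definition decode_db :: "'a \<Rightarrow> 'a \<Rightarrow> ('r, 'a, 'd) graph_db \<Rightarrow> ('r, 'a, 'd) rel_db" where
  "decode_db tid vid = (\<lambda>(SG, IG).
     (decode_schema vid SG, \<lambda>r\<in>rel_of SG ` gverts SG. {t. (r, t) \<in> decode_tuples tid vid IG}))"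

lemma Domain_proper_props: "Domain (proper_props vid P) = Domain P - {vid}"
  by (auto simp: proper_props_def)

lemma single_valued_proper_props: "single_valued P \<Longrightarrow> single_valued (proper_props vid P)"
  by (auto simp: proper_props_def single_valued_def)

lemma Domain_tuple_props:
  assumes "vid \<in> Domain P"
  shows "Domain (tuple_props tid vid P) = insert tid (Domain P - {vid})"
proof -
  have "Domain (tuple_props tid vid P) = (\<lambda>p. if fst p = vid then tid else fst p) ` P"
    unfolding tuple_props_def Domain_fst image_image by (rule image_cong) auto
  also have "\<dots> = (\<lambda>a. if a = vid then tid else a) ` Domain P"
    unfolding Domain_fst image_image ..
  finally show ?thesis using assms by auto
qed

text \<open>A property already named \<open>tid\<close> could clash with the renamed
  \<open>vid\<close>.\<close>

lemma single_valued_tuple_props: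
  assumes "single_valued P" "tid \<notin> Domain P"
  shows "single_valued (tuple_props tid vid P)"
  using assms by (auto simp: tuple_props_def single_valued_def split: if_splits)

lemma tuple_props_tid_iff:
  assumes "tid \<notin> Domain P"
  shows "(tid, c) \<in> tuple_props tid vid P \<longleftrightarrow> (vid, c) \<in> P"
  using assms by (force simp: tuple_props_def split: if_splits)

lemma tuple_props_iff:
  assumes "a \<noteq> tid"
  shows "(a, c) \<in> tuple_props tid vid P \<longleftrightarrow> a \<noteq> vid \<and> (a, c) \<in> P"
  using assms by (force simp: tuple_props_def split: if_splits)

section \<open>The decoded database is a relational database\<close>

context
  fixes tid vid :: 'a and null :: 'd and vals :: "data_type \<Rightarrow> 'd set"
    and SG :: "('r, 'a) schema_graph" and IG :: "('r, 'a \<times> 'd) property_graph"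
  assumes graph_db: "(SG, IG) \<in> graph_dbs vals"
    and decodable: "decodable_db tid vid null (SG, IG)"
begin

lemma attrs_decode_schema:
  "v \<in> gverts SG \<Longrightarrow> attrs (decode_schema vid SG) (rel_of SG v) = Domain (vprops SG v) - {vid}"
  using decodable fun_of_image[of "rel_of SG" "gverts SG" v]
  by (simp add: decode_schema_def decodable_db_def Domain_proper_props)

lemma attr_type_decode_schema:
  "v \<in> gverts SG \<Longrightarrow>
    attr_type (decode_schema vid SG) (rel_of SG v) = fun_of (proper_props vid (vprops SG v))"
  using decodable fun_of_image[of "rel_of SG" "gverts SG" v]
  by (simp add: decode_schema_def decodable_db_def)

text \<open>Distinct relations on the schema vertices make \<open>attrs\<close> and
  \<open>attr_type\<close> functions and leave each relation at most one primary key. A schema graph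
  admits \<open>vid\<close> in key lists, as \<open>vid\<close> is a property;
  \<open>decodable_db\<close> excludes it. The target list of a foreign key is harmless because it
  is the primary key of the head.\<close>

lemma rel_schemas_decode_schema: "decode_schema vid SG \<in> rel_schemas tid vid"
proof -
  let ?S = "decode_schema vid SG"
  have SG: "SG \<in> schema_graphs" using graph_db by (simp add: graph_dbs_def)
  then have fin: "finite (gverts SG)" "finite (garcs SG)"
    by (auto simp: schema_graphs_def wf_property_graph_def fin_digraph_def fin_digraph_axioms_def)
  have wf: "gtail SG e \<in> gverts SG" "ghead SG e \<in> gverts SG" if "e \<in> garcs SG" for e
    using SG that by (auto simp: schema_graphs_def wf_property_graph_def fin_digraph_def wf_digraph_def)
  have finp: "finite (vprops SG v)" if "v \<in> gverts SG" for v
    using SG that by (auto simp: schema_graphs_def wf_property_graph_def)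
  have inj: "inj_on (rel_of SG) (gverts SG)" using decodable by (simp add: decodable_db_def)
  have rels: "rels ?S = rel_of SG ` gverts SG" by (simp add: decode_schema_def)
  have sv: "single_valued (vprops SG v)" "tid \<notin> Domain (vprops SG v)"
    "\<And>as. pk SG v = Some as \<Longrightarrow> vid \<notin> set as"
    "\<And>ty. (tid, ty) \<notin> vprops SG v" if "v \<in> gverts SG" for v
    using decodable that by (simp_all add: decodable_db_def Domain_iff)
  have pk: "set as \<subseteq> Domain (vprops SG v)" if "v \<in> gverts SG" "pk SG v = Some as" for v as
    using SG that by (auto simp: schema_graphs_def Domain_fst)
  have fk: "set (fk_source SG e) \<subseteq> Domain (vprops SG (gtail SG e))" if "e \<in> garcs SG" for e
    using SG that by (auto simp: schema_graphs_def Domain_fst PiE_iff)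
  have arc: "length (fk_source SG e) = length (fk_dest SG e)" "vid \<notin> set (fk_source SG e)"
     "pk SG (ghead SG e) = Some (fk_dest SG e)" if "e \<in> garcs SG" for e
    using decodable that by (simp_all add: decodable_db_def)
  have prim: "Primary_Key r as \<in> keys ?S \<longleftrightarrow> (\<exists>v\<in>gverts SG. r = rel_of SG v \<and> pk SG v = Some as)" for r as
    by (force simp: decode_schema_def)
  have "attrs ?S \<in> rels ?S \<rightarrow>\<^sub>E {X. finite X \<and> X \<subseteq> UNIV - {tid, vid}}"
    unfolding decode_schema_def rel_schema.simps
    by (rule fun_of_PiE[OF single_valued_image[OF inj]])
      (auto simp: Domain_proper_props finp finite_Domain sv(4))
  moreover have "attr_type ?S \<in> (\<Pi>\<^sub>E r\<in>rels ?S. attrs ?S r \<rightarrow>\<^sub>E UNIV)"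
    unfolding rels
  proof (subst decode_schema_def, unfold rel_schema.simps,
      rule fun_of_PiE[OF single_valued_image[OF inj]])
    fix r y
    assume "(r, y) \<in> (\<lambda>v. (rel_of SG v, fun_of (proper_props vid (vprops SG v)))) ` gverts SG"
    then obtain v where v: "v \<in> gverts SG" "r = rel_of SG v" "y = fun_of (proper_props vid (vprops SG v))"
      by blast
    have "fun_of (proper_props vid (vprops SG v)) \<in> Domain (vprops SG v) - {vid} \<rightarrow>\<^sub>E UNIV"
      by (rule fun_of_PiE) (simp_all add: v sv single_valued_proper_props Domain_proper_props)
    then show "y \<in> attrs ?S r \<rightarrow>\<^sub>E UNIV"
      by (simp add: v attrs_decode_schema)
  qed simp
  moreover have "wf_key ?S k" if k: "k \<in> keys ?S" for k
  proof (cases k)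
    case (Primary_Key r as)
    then obtain v where "v \<in> gverts SG" "r = rel_of SG v" "pk SG v = Some as"
      using k unfolding Primary_Key prim by blast
    then show ?thesis
      using pk sv(3) by (auto simp: Primary_Key wf_key_def rels attrs_decode_schema)
  next
    case (Foreign_Key r as s bs)
    then obtain e where e: "e \<in> garcs SG" "r = rel_of SG (gtail SG e)" "as = fk_source SG e"
      "s = rel_of SG (ghead SG e)" "bs = fk_dest SG e"
      using k by (auto simp: decode_schema_def)
    then have "Primary_Key s bs \<in> keys ?S"
      using prim wf arc by auto
    then show ?thesis
      using e fk[of e] wf[of e] arc[of e] by (auto simp: Foreign_Key wf_key_def rels attrs_decode_schema)
  qed
  moreover have "finite (keys ?S)" "finite (rels ?S)"
    using fin by (simp_all add: decode_schema_def)
  moreover have "as = as'" if "Primary_Key r as \<in> keys ?S" "Primary_Key r as' \<in> keys ?S" for r as as'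
    using that inj by (auto simp: prim inj_on_def)
  ultimately show ?thesis
    unfolding rel_schemas_def by blast
qed

text \<open>Correspondence cannot be tested without \<open>vals\<close>, so
  \<open>decodable_db\<close> compares attributes with every schema vertex of the same relation. The
  vertex that conformance provides is among these.\<close>

lemma instance_vertex:
  assumes "v \<in> gverts IG"
  obtains w where "w \<in> gverts SG" "rel_of IG v = rel_of SG w"
    "Domain (vprops IG v) = Domain (vprops SG w)" "props_conform vals (vprops IG v) (vprops SG w)"
proof -
  have "\<forall>v\<in>gverts IG. \<exists>w\<in>gverts SG. vertex_corresponds vals SG IG v w"
    using graph_db by (simp add: graph_dbs_def instance_graphs_def)
  with assms obtain w where w: "w \<in> gverts SG" and "vertex_corresponds vals SG IG v w"
    by blast
  then have *: "rel_of IG v = rel_of SG w" "props_conform vals (vprops IG v) (vprops SG w)"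
    by (simp_all add: vertex_corresponds_def)
  have "\<forall>w\<in>gverts SG. rel_of IG v = rel_of SG w \<longrightarrow> Domain (vprops IG v) = Domain (vprops SG w)"
    using decodable assms by (simp add: decodable_db_def)
  with w * that show ?thesis by blast
qed

lemma decode_tuple_props:
  assumes "v \<in> gverts IG"
  shows "single_valued (tuple_props tid vid (vprops IG v))"
    and "Domain (tuple_props tid vid (vprops IG v)) =
      insert tid (attrs (decode_schema vid SG) (rel_of IG v))"
    and "tid \<notin> Domain (vprops IG v)" and "vid \<in> Domain (vprops IG v)"
proof -
  obtain w where w: "w \<in> gverts SG" "rel_of IG v = rel_of SG w"
    "Domain (vprops IG v) = Domain (vprops SG w)" "props_conform vals (vprops IG v) (vprops SG w)"
    by (rule instance_vertex[OF assms])
  then show *: "tid \<notin> Domain (vprops IG v)" "vid \<in> Domain (vprops IG v)"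
    using decodable by (auto simp: decodable_db_def)
  show "single_valued (tuple_props tid vid (vprops IG v))"
    using * decodable assms by (intro single_valued_tuple_props) (auto simp: decodable_db_def)
  show "Domain (tuple_props tid vid (vprops IG v)) =
      insert tid (attrs (decode_schema vid SG) (rel_of IG v))"
    using w * by (simp add: Domain_tuple_props attrs_decode_schema)
qed

text \<open>Conformance gives each value some type of its attribute in the schema vertex; as the
  properties there are single-valued, this is the type that decoding declares. Only
  \<open>null\<close> as a \<open>tid\<close> value has to be excluded separately, since
  \<open>vals Integer\<close> may contain it.\<close>

lemma rel_tuples_decode:
  assumes "v \<in> gverts IG"
  shows "fun_of (tuple_props tid vid (vprops IG v)) \<in>
    rel_tuples tid null vals (decode_schema vid SG) (rel_of IG v)"
  unfolding rel_tuples_def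
proof (rule fun_of_PiE)
  note props = decode_tuple_props[OF assms]
  obtain w where w: "w \<in> gverts SG" "rel_of IG v = rel_of SG w"
    "Domain (vprops IG v) = Domain (vprops SG w)"
    and conf: "props_conform vals (vprops IG v) (vprops SG w)"
    by (rule instance_vertex[OF assms])
  have sv: "single_valued (vprops SG w)" "(vid, Integer) \<in> vprops SG w"
    and null: "(vid, null) \<notin> vprops IG v"
    using decodable w(1) assms by (auto simp: decodable_db_def)
  show "single_valued (tuple_props tid vid (vprops IG v))"
    by (rule props)
  show "insert tid (attrs (decode_schema vid SG) (rel_of IG v)) = Domain (tuple_props tid vid (vprops IG v))"
    by (simp add: props)
  fix a c assume ac: "(a, c) \<in> tuple_props tid vid (vprops IG v)"
  show "c \<in> (if a = tid then vals Integer - {null}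
    else vals (attr_type (decode_schema vid SG) (rel_of IG v) a))"
  proof (cases "a = tid")
    case True
    with ac props have "(vid, c) \<in> vprops IG v" by (simp add: tuple_props_tid_iff)
    moreover from this conf sv have "c \<in> vals Integer"
      by (auto simp: props_conform_def dest: single_valuedD)
    ultimately show ?thesis using True null by auto
  next
    case False
    with ac have *: "(a, c) \<in> vprops IG v" "a \<noteq> vid" by (simp_all add: tuple_props_iff)
    with conf obtain ty where ty: "(a, ty) \<in> vprops SG w" "c \<in> vals ty"
      by (auto simp: props_conform_def)
    then have "fun_of (proper_props vid (vprops SG w)) a = ty"
      using * sv(1) by (intro fun_of_eq single_valued_proper_props) (auto simp: proper_props_def)
    with ty False show ?thesis by (simp add: w attr_type_decode_schema)
  qed
qed

text \<open>The relation of each instance vertex is that of some schema vertex, so restricting the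
  instance to the decoded relations loses no tuple. The left-hand side is the set that
  \<open>enc_rel_db\<close> encodes.\<close>

lemma Sigma_decode_tuples:
  "(SIGMA r:rels (decode_schema vid SG). snd (decode_db tid vid (SG, IG)) r) = decode_tuples tid vid IG"
proof -
  have "rel_of IG v \<in> rel_of SG ` gverts SG" if "v \<in> gverts IG" for v
    using instance_vertex[OF that] by (metis imageI)
  then show ?thesis
    by (auto simp: decode_db_def decode_schema_def decode_tuples_def)
qed

lemma rel_dbs_decode_db: "decode_db tid vid (SG, IG) \<in> rel_dbs tid vid null vals"
proof -
  let ?S = "decode_schema vid SG" and ?I = "snd (decode_db tid vid (SG, IG))"
  have fin: "finite (decode_tuples tid vid IG)"
    using graph_db
    by (auto simp: graph_dbs_def instance_graphs_def wf_property_graph_def fin_digraph_def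
        fin_digraph_axioms_def decode_tuples_def)
  have mem: "\<exists>v\<in>gverts IG. r = rel_of IG v \<and> t = fun_of (tuple_props tid vid (vprops IG v))"
    if "r \<in> rels ?S" "t \<in> ?I r" for r t
    using that Sigma_decode_tuples by (auto simp: decode_tuples_def)
  have tid: "(vid, fun_of (tuple_props tid vid (vprops IG v)) tid) \<in> vprops IG v"
    if "v \<in> gverts IG" for v
  proof -
    note props = decode_tuple_props[OF that]
    obtain c where c: "(vid, c) \<in> vprops IG v" using props by blast
    then have "fun_of (tuple_props tid vid (vprops IG v)) tid = c"
      using props by (intro fun_of_eq) (simp_all add: tuple_props_tid_iff)
    with c show ?thesis by simp
  qed
  have "?I \<in> rel_instances tid null vals ?S"
    unfolding rel_instances_def
  proof (rule PiE_I)
    fix r assume r: "r \<in> rels ?S"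
    have "?I r \<subseteq> snd ` decode_tuples tid vid IG"
      using r Sigma_decode_tuples by force
    with fin have "finite (?I r)" by (meson finite_imageI finite_subset)
    moreover have "?I r \<subseteq> rel_tuples tid null vals ?S r"
      using mem[OF r] rel_tuples_decode by blast
    \<comment> \<open>A \<open>tid\<close> value shared by two tuples is a \<open>vid\<close> value
      shared by their vertices, which the last condition of \<open>decodable_db\<close> then
      identifies.\<close>
    moreover have "inj_on (\<lambda>t. t tid) (?I r)"
    proof (rule inj_onI)
      fix t t' assume "t \<in> ?I r" "t' \<in> ?I r" and eq: "t tid = t' tid"
      then obtain v w where vw: "v \<in> gverts IG" "w \<in> gverts IG" "r = rel_of IG v" "r = rel_of IG w"
        "t = fun_of (tuple_props tid vid (vprops IG v))" "t' = fun_of (tuple_props tid vid (vprops IG w))"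
        using mem[OF r] by metis
      with tid[of v] tid[of w] eq have "\<exists>c. (vid, c) \<in> vprops IG v \<and> (vid, c) \<in> vprops IG w" by auto
      with vw decodable have "v = w" by (auto simp: decodable_db_def)
      with vw show "t = t'" by simp
    qed
    ultimately show "?I r \<in> {X. finite X \<and> X \<subseteq> rel_tuples tid null vals ?S r \<and> inj_on (\<lambda>t. t tid) X}"
      by simp
  qed (simp add: decode_db_def decode_schema_def)
  then show ?thesis
    using rel_schemas_decode_schema by (simp add: rel_dbs_def decode_db_def)
qed

end

section \<open>Decoding inverts the complete mapping\<close>

lemma rel_schemasD:
  assumes "S \<in> rel_schemas tid vid"
  shows "finite (rels S)" "attrs S \<in> extensional (rels S)" "attr_type S \<in> extensional (rels S)"
    "r \<in> rels S \<Longrightarrow> finite (attrs S r)" "r \<in> rels S \<Longrightarrow> tid \<notin> attrs S r"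
    "r \<in> rels S \<Longrightarrow> vid \<notin> attrs S r" "r \<in> rels S \<Longrightarrow> attr_type S r \<in> extensional (attrs S r)"
    "finite (keys S)"
    "Primary_Key r as \<in> keys S \<Longrightarrow> r \<in> rels S \<and> set as \<subseteq> attrs S r"
    "Primary_Key r as \<in> keys S \<Longrightarrow> Primary_Key r as' \<in> keys S \<Longrightarrow> as = as'"
    "Foreign_Key r as s bs \<in> keys S \<Longrightarrow>
      r \<in> rels S \<and> s \<in> rels S \<and> set as \<subseteq> attrs S r \<and> length as = length bs \<and> Primary_Key s bs \<in> keys S"
proof -
  have wf: "k \<in> keys S \<Longrightarrow> wf_key S k" for k
    using assms by (simp add: rel_schemas_def)
  show "Primary_Key r as \<in> keys S \<Longrightarrow> r \<in> rels S \<and> set as \<subseteq> attrs S r"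
    using wf by (force simp: wf_key_def)
  show "Foreign_Key r as s bs \<in> keys S \<Longrightarrow>
      r \<in> rels S \<and> s \<in> rels S \<and> set as \<subseteq> attrs S r \<and> length as = length bs \<and> Primary_Key s bs \<in> keys S"
    using wf by (force simp: wf_key_def)
qed (use assms in \<open>auto simp: rel_schemas_def PiE_iff\<close>)

context
  fixes tid vid :: 'a and null :: 'd and vals :: "data_type \<Rightarrow> 'd set"
    and S :: "('r, 'a) rel_schema" and I :: "'r \<Rightarrow> ('a \<Rightarrow> 'd) set"
    and SG :: "('r, 'a) schema_graph" and IG :: "('r, 'a \<times> 'd) property_graph"
  assumes tid_vid: "tid \<noteq> vid"
    and rel_db: "(S, I) \<in> rel_dbs tid vid null vals"
    and complete_schema: "complete_schema_graph vid S SG"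
    and complete_instance: "complete_instance_graph tid vid S I IG"
begin

text \<open>Every schema vertex is some \<open>vS r\<close> and every instance vertex some
  \<open>vI (r, t)\<close>; labels give back \<open>r\<close> and properties give back
  \<open>t\<close>, so the chosen names cancel. Distinctness of \<open>tid\<close> values within a
  relation yields the last condition of \<open>decodable_db\<close>.\<close>

lemma decodable_complete: "decodable_db tid vid null (SG, IG)"
  and decode_complete: "decode_db tid vid (SG, IG) = (S, I)"
proof -
  have S: "S \<in> rel_schemas tid vid" and I: "I \<in> rel_instances tid null vals S"
    using rel_db by (simp_all add: rel_dbs_def)
  note SD = rel_schemasD[OF S]
  have tup: "t \<in> extensional (insert tid (attrs S r))" "t tid \<noteq> null"
    if "r \<in> rels S" "t \<in> I r" for r t
  proof -
    have "t \<in> rel_tuples tid null vals S r"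
      using I that by (auto simp: rel_instances_def)
    then show "t \<in> extensional (insert tid (attrs S r))" "t tid \<noteq> null"
      unfolding rel_tuples_def by (auto simp: PiE_iff)
  qed
  have injI: "t = t'" if "r \<in> rels S" "t \<in> I r" "t' \<in> I r" "t tid = t' tid" for r t t'
  proof -
    have "inj_on (\<lambda>t. t tid) (I r)"
      using I that(1) by (auto simp: rel_instances_def)
    with that show ?thesis by (auto dest: inj_onD)
  qed
  from complete_schema obtain vS eS where
    vS: "bij_betw vS (rels S) (gverts SG)" and eS: "bij_betw eS (foreign_keys S) (garcs SG)"
    and v: "\<forall>r\<in>rels S. vlabel SG (vS r) = Name r \<and>
      vprops SG (vS r) = {(a, attr_type S r a) | a. a \<in> attrs S r} \<union> {(vid, Integer)} \<and>
      (\<forall>as. pk SG (vS r) = Some as \<longleftrightarrow> Primary_Key r as \<in> keys S)"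
    and e: "\<forall>(r, as, s, bs)\<in>foreign_keys S. let e = eS (r, as, s, bs) in
      gtail SG e = vS r \<and> ghead SG e = vS s \<and> elabel SG e = Dash r s \<and> eprops SG e = {} \<and>
      fk_source SG e = as \<and> fk_dest SG e = bs"
    unfolding complete_schema_graph_def by blast
  have verts: "gverts SG = vS ` rels S" and arcs: "garcs SG = eS ` foreign_keys S"
    using vS eS by (auto simp: bij_betw_def)
  have v': "rel_of SG (vS r) = r"
    "vprops SG (vS r) = insert (vid, Integer) ((\<lambda>a. (a, attr_type S r a)) ` attrs S r)"
    "pk SG (vS r) = Some as \<longleftrightarrow> Primary_Key r as \<in> keys S" if "r \<in> rels S" for r as
    using v that by auto
  have e': "gtail SG (eS (r, as, s, bs)) = vS r" "ghead SG (eS (r, as, s, bs)) = vS s"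
    "fk_source SG (eS (r, as, s, bs)) = as" "fk_dest SG (eS (r, as, s, bs)) = bs"
    if "(r, as, s, bs) \<in> foreign_keys S" for r as s bs
    using e that by (auto simp: Let_def)
  from complete_instance obtain vI where
    vI: "bij_betw vI (SIGMA r:rels S. I r) (gverts IG)"
    and w: "\<forall>r\<in>rels S. \<forall>t\<in>I r. vlabel IG (vI (r, t)) = Name r \<and>
        vprops IG (vI (r, t)) = {(a, t a) | a. a \<in> attrs S r} \<union> {(vid, t tid)}"
    unfolding complete_instance_graph_def by blast
  have vertsI: "gverts IG = vI ` (SIGMA r:rels S. I r)"
    using vI by (auto simp: bij_betw_def)
  have w': "rel_of IG (vI (r, t)) = r"
    "vprops IG (vI (r, t)) = insert (vid, t tid) ((\<lambda>a. (a, t a)) ` attrs S r)"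
    if "r \<in> rels S" "t \<in> I r" for r t
    using w that by auto
  have fkD: "Foreign_Key r as s bs \<in> keys S" if "(r, as, s, bs) \<in> foreign_keys S" for r as s bs
    using that by (simp add: foreign_keys_def)

  show "decodable_db tid vid null (SG, IG)"
    unfolding decodable_db_def prod.case
  proof (intro conjI)
    show "inj_on (rel_of SG) (gverts SG)"
      by (auto simp: inj_on_def verts v')
    show "\<forall>v\<in>gverts SG. single_valued (vprops SG v) \<and> (vid, Integer) \<in> vprops SG v \<and>
        tid \<notin> Domain (vprops SG v) \<and> (\<forall>as. pk SG v = Some as \<longrightarrow> vid \<notin> set as)"
    proof
      fix v assume "v \<in> gverts SG"
      then obtain r where r: "r \<in> rels S" "v = vS r" by (auto simp: verts)
      \<comment> \<open>\<open>vid\<close> itself is a property, so the absence of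
        \<open>tid\<close> rests on \<open>tid \<noteq> vid\<close>; and \<open>vid\<close> gets no
        second type because it is not an attribute.\<close>
      have "single_valued (vprops SG v)" "tid \<notin> Domain (vprops SG v)"
        using r tid_vid SD(5,6)[of r] by (auto simp: v' single_valued_def)
      moreover have "vid \<notin> set as" if "pk SG v = Some as" for as
        using that r SD(6)[of r] SD(9)[of r as] by (auto simp: v')
      ultimately show "single_valued (vprops SG v) \<and> (vid, Integer) \<in> vprops SG v \<and>
          tid \<notin> Domain (vprops SG v) \<and> (\<forall>as. pk SG v = Some as \<longrightarrow> vid \<notin> set as)"
        using r by (auto simp: v')
    qed
    show "\<forall>e\<in>garcs SG. length (fk_source SG e) = length (fk_dest SG e) \<and>
        vid \<notin> set (fk_source SG e) \<and> pk SG (ghead SG e) = Some (fk_dest SG e)"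
    proof
      fix e assume "e \<in> garcs SG"
      then obtain r as s bs where k: "(r, as, s, bs) \<in> foreign_keys S" "e = eS (r, as, s, bs)"
        by (auto simp: arcs)
      with SD(11)[OF fkD[OF k(1)]] SD(6)[of r] show "length (fk_source SG e) = length (fk_dest SG e) \<and>
          vid \<notin> set (fk_source SG e) \<and> pk SG (ghead SG e) = Some (fk_dest SG e)"
        by (auto simp: e' v')
    qed
    show "\<forall>v\<in>gverts IG. single_valued (vprops IG v) \<and> (vid, null) \<notin> vprops IG v \<and>
        (\<forall>w\<in>gverts SG. rel_of IG v = rel_of SG w \<longrightarrow> Domain (vprops IG v) = Domain (vprops SG w))"
    proof
      fix v assume "v \<in> gverts IG"
      then obtain r t where r: "r \<in> rels S" "t \<in> I r" "v = vI (r, t)" by (auto simp: vertsI)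
      have "single_valued (vprops IG v)" "(vid, null) \<notin> vprops IG v"
        using r SD(6)[of r] tup(2)[of r t] by (auto simp: w' single_valued_def)
      moreover have "Domain (vprops IG v) = Domain (vprops SG w)"
        if "w \<in> gverts SG" "rel_of IG v = rel_of SG w" for w
        using that r by (auto simp: verts w' v')
      ultimately show "single_valued (vprops IG v) \<and> (vid, null) \<notin> vprops IG v \<and>
        (\<forall>w\<in>gverts SG. rel_of IG v = rel_of SG w \<longrightarrow> Domain (vprops IG v) = Domain (vprops SG w))"
        by blast
    qed
    show "\<forall>v\<in>gverts IG. \<forall>w\<in>gverts IG. rel_of IG v = rel_of IG w \<longrightarrow>
        (\<exists>c. (vid, c) \<in> vprops IG v \<and> (vid, c) \<in> vprops IG w) \<longrightarrow> v = w"
    proof (intro ballI impI)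
      fix v w assume "v \<in> gverts IG" "w \<in> gverts IG" and eq: "rel_of IG v = rel_of IG w"
        and c: "\<exists>c. (vid, c) \<in> vprops IG v \<and> (vid, c) \<in> vprops IG w"
      then obtain r t s u where r: "r \<in> rels S" "t \<in> I r" "v = vI (r, t)"
        "s \<in> rels S" "u \<in> I s" "w = vI (s, u)" by (auto simp: vertsI)
      with eq have [simp]: "s = r" by (simp add: w')
      have "t tid = u tid"
        using c r SD(6)[of r] by (auto simp: w')
      with r injI[of r t u] show "v = w" by simp
    qed
  qed

  have pp: "proper_props vid (vprops SG (vS r)) = (\<lambda>a. (a, attr_type S r a)) ` attrs S r"
    if "r \<in> rels S" for r
    using that SD(6)[of r] by (auto simp: proper_props_def v')
  \<comment> \<open>Renaming \<open>vid\<close> to \<open>tid\<close> turns the properties into the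
    graph of \<open>t\<close> on its whole domain, and \<open>t\<close> is extensional
    there.\<close>
  have tp: "fun_of (tuple_props tid vid (vprops IG (vI (r, t)))) = t"
    if "r \<in> rels S" "t \<in> I r" for r t
  proof -
    have "tuple_props tid vid (vprops IG (vI (r, t))) = (\<lambda>a. (a, t a)) ` insert tid (attrs S r)"
      using that SD(6)[of r] unfolding tuple_props_def w'[OF that] image_insert image_image prod.case
      by (intro arg_cong2[where f = insert] image_cong refl) auto
    with tup(1)[OF that] show ?thesis by (simp add: fun_of_graph del: image_insert)
  qed
  have "attrs (decode_schema vid SG) = fun_of ((\<lambda>r. (r, attrs S r)) ` rels S)"
    unfolding decode_schema_def rel_schema.simps verts image_image
    by (intro arg_cong[where f = fun_of] image_cong refl) (simp add: v'(1) pp)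
  moreover have "attr_type (decode_schema vid SG) = fun_of ((\<lambda>r. (r, attr_type S r)) ` rels S)"
    unfolding decode_schema_def rel_schema.simps verts image_image
    by (intro arg_cong[where f = fun_of] image_cong refl) (simp add: v'(1) pp fun_of_graph SD(7))
  moreover have "keys (decode_schema vid SG) = keys S"
  proof (rule set_eqI)
    fix k
    show "k \<in> keys (decode_schema vid SG) \<longleftrightarrow> k \<in> keys S"
    proof (cases k)
      case (Primary_Key r as)
      have "k \<in> keys (decode_schema vid SG) \<longleftrightarrow> (\<exists>v\<in>gverts SG. r = rel_of SG v \<and> pk SG v = Some as)"
        by (force simp: decode_schema_def Primary_Key)
      also have "\<dots> \<longleftrightarrow> k \<in> keys S"
        using SD(9)[of r as] by (auto simp: Primary_Key verts v')
      finally show ?thesis .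
    next
      case (Foreign_Key r as s bs)
      have "k \<in> keys (decode_schema vid SG) \<longleftrightarrow> (\<exists>(r', as', s', bs')\<in>foreign_keys S.
          r = rel_of SG (vS r') \<and> as = as' \<and> s = rel_of SG (vS s') \<and> bs = bs')"
        by (auto simp: decode_schema_def Foreign_Key arcs e' image_iff intro!: bexI)
      also have "\<dots> \<longleftrightarrow> (\<exists>k\<in>foreign_keys S. k = (r, as, s, bs))"
      proof (rule bex_cong[OF refl])
        fix k assume k: "k \<in> foreign_keys S"
        obtain r' as' s' bs' where [simp]: "k = (r', as', s', bs')" by (cases k)
        show "(case k of (r', as', s', bs') \<Rightarrow>
            r = rel_of SG (vS r') \<and> as = as' \<and> s = rel_of SG (vS s') \<and> bs = bs') \<longleftrightarrow> k = (r, as, s, bs)"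
          using SD(11)[OF fkD[OF k[simplified]]] by (auto simp: v')
      qed
      also have "\<dots> \<longleftrightarrow> (r, as, s, bs) \<in> foreign_keys S"
        by blast
      finally show ?thesis by (simp add: Foreign_Key foreign_keys_def)
    qed
  qed
  ultimately have "decode_schema vid SG = S"
    using SD(2,3) by (intro rel_schema.equality)
      (auto simp: fun_of_graph decode_schema_def verts image_image v')
  \<comment> \<open>Writing the right-hand side as an identity image lets \<open>image_cong\<close>
    compare both sides pair by pair.\<close>
  moreover have "decode_tuples tid vid IG = (\<lambda>p. p) ` (SIGMA r:rels S. I r)"
    unfolding decode_tuples_def vertsI image_image
    by (intro image_cong refl) (auto simp: w'(1) tp)
  moreover have "rel_of SG ` gverts SG = rels S"
    by (simp add: verts image_image v')
  moreover have "I \<in> extensional (rels S)"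
    using I by (simp add: rel_instances_def PiE_iff)
  ultimately show "decode_db tid vid (SG, IG) = (S, I)"
    by (auto simp: decode_db_def restrict_def extensional_def fun_eq_iff)
qed

end

section \<open>Decoding on codes\<close>

text \<open>Since functions are encoded by their graphs, the code of a decoded function is that of a
  property set, and no function has to be evaluated.\<close>

lemma enc_fun_fun_of:
  assumes "single_valued R" "X = Domain R"
  shows "enc_fun X e f (fun_of R) = enc_set (enc_pair e f) R"
  using graph_fun_of[OF assms(1)] by (simp add: enc_fun_def assms(2))

lemma inj_enc_data_type: "inj enc_data_type"
  by (auto simp: inj_def enc_data_type_def split: data_type.splits)

lemma pfst_enc_pair [simp]: "pfst (enc_pair e f p) = e (fst p)"
  and psnd_enc_pair [simp]: "psnd (enc_pair e f p) = f (snd p)"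
  by (simp_all add: enc_pair_def split_def)

lemma enc_pair_Pair [simp]: "enc_pair e f (a, c) = prod_encode (e a, f c)"
  by (simp add: enc_pair_def)

lemma enc_pair_eq_iff: "inj e \<Longrightarrow> inj f \<Longrightarrow> enc_pair e f p = enc_pair e f q \<longleftrightarrow> p = q"
  by (cases p; cases q) (simp add: inj_eq)

lemma enc_pair_mem_iff:
  "inj e \<Longrightarrow> inj f \<Longrightarrow> prod_encode (e a, f c) \<in> enc_pair e f ` P \<longleftrightarrow> (a, c) \<in> P"
  unfolding enc_pair_Pair[symmetric] by (auto simp: enc_pair_eq_iff simp del: enc_pair_Pair)

lemma pfst_image_enc_pair: "pfst ` enc_pair e f ` P = e ` Domain P"
  by (simp add: image_image Domain_fst)

lemma functional_code_enc_set:
  assumes "finite P" "inj e" "inj f"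
  shows "functional_code (enc_set (enc_pair e f) P) \<longleftrightarrow> single_valued P"
proof -
  have "functional_code (enc_set (enc_pair e f) P) \<longleftrightarrow>
      (\<forall>p\<in>P. \<forall>q\<in>P. fst p = fst q \<longrightarrow> p = q)"
    using assms by (simp add: functional_code_def enc_pair_eq_iff inj_eq)
  also have "\<dots> \<longleftrightarrow> single_valued P"
    by (fastforce simp: single_valued_def)
  finally show ?thesis .
qed

lemma nth_code_enc_label [simp]: "nth_code 0 (enc_label er l) = er (source_rel l)"
  by (cases l) (simp_all add: enc_label_def del: list_encode.simps)

context
  fixes tid vid :: 'a and null :: 'd and vals :: "data_type \<Rightarrow> 'd set"
    and er :: "'r \<Rightarrow> nat" and ea :: "'a \<Rightarrow> nat" and ed :: "'d \<Rightarrow> nat"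
    and SG :: "('r, 'a) schema_graph" and IG :: "('r, 'a \<times> 'd) property_graph"
    and x :: nat
  assumes inj: "inj er" "inj ea" "inj ed"
    and graph_db: "(SG, IG) \<in> graph_dbs vals"
    and x: "x = enc_graph_db er ea ed (SG, IG)"
begin

lemma finite_graph:
  "finite (gverts SG)" "finite (garcs SG)" "finite (gverts IG)" "finite (garcs IG)"
  using graph_db
  by (auto simp: graph_dbs_def schema_graphs_def instance_graphs_def wf_property_graph_def
      fin_digraph_def fin_digraph_axioms_def)

lemma finite_props:
  "v \<in> gverts SG \<Longrightarrow> finite (vprops SG v)" "v \<in> gverts IG \<Longrightarrow> finite (vprops IG v)"
  using graph_db
  by (auto simp: graph_dbs_def schema_graphs_def instance_graphs_def wf_property_graph_def)

lemma arc_verts: "e \<in> garcs SG \<Longrightarrow> gtail SG e \<in> gverts SG" "e \<in> garcs SG \<Longrightarrow> ghead SG e \<in> gverts SG"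
  using graph_db
  by (auto simp: graph_dbs_def schema_graphs_def wf_property_graph_def fin_digraph_def wf_digraph_def)

text \<open>The dictionary between numbers and graphs: all later access to \<open>x\<close> goes
  through these equations.\<close>

lemma parts:
  "set_decode (schema_graph_part 0 x) = gverts SG"
  "set_decode (schema_graph_part (Suc 0) x) = garcs SG"
  "set_decode (instance_part 0 x) = gverts IG"
  "v \<in> gverts SG \<Longrightarrow> schema_rel x v = er (rel_of SG v)"
  "v \<in> gverts SG \<Longrightarrow> schema_props x v = enc_set (enc_pair ea enc_data_type) (vprops SG v)"
  "v \<in> gverts SG \<Longrightarrow> apply_code (schema_part (Suc 0) x) v = enc_option (enc_list ea) (pk SG v)"
  "e \<in> garcs SG \<Longrightarrow> apply_code (schema_graph_part 2 x) e = gtail SG e"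
  "e \<in> garcs SG \<Longrightarrow> apply_code (schema_graph_part 3 x) e = ghead SG e"
  "e \<in> garcs SG \<Longrightarrow> apply_code (schema_part 2 x) e = enc_list ea (fk_source SG e)"
  "e \<in> garcs SG \<Longrightarrow> apply_code (schema_part 3 x) e = enc_list ea (fk_dest SG e)"
  "v \<in> gverts IG \<Longrightarrow> instance_rel x v = er (rel_of IG v)"
  "v \<in> gverts IG \<Longrightarrow> instance_props x v = enc_set (enc_pair ea ed) (vprops IG v)"
  by (simp_all add: x enc_graph_db_def enc_schema_graph_def enc_property_graph_def
      finite_graph apply_code_enc_fun del: list_encode.simps)

lemma decode_props [simp]:
  "v \<in> gverts SG \<Longrightarrow> set_decode (schema_props x v) = enc_pair ea enc_data_type ` vprops SG v"
  "v \<in> gverts IG \<Longrightarrow> set_decode (instance_props x v) = enc_pair ea ed ` vprops IG v"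
  by (simp_all add: parts finite_props)

text \<open>Injectivity of the encodings makes each comparison of codes equivalent to the comparison
  of what they encode; the conditions are matched one at a time, in the order of the
  definitions.\<close>

lemma decodable_code_iff:
  "decodable_code (ea tid) (ea vid) (ed null) x \<longleftrightarrow> decodable_db tid vid null (SG, IG)"
proof -
  have c1: "(\<forall>v\<in>gverts SG. \<forall>w\<in>gverts SG. schema_rel x v = schema_rel x w \<longrightarrow> v = w) \<longleftrightarrow>
      inj_on (rel_of SG) (gverts SG)"
    by (simp add: inj_on_def parts(4) inj_eq[OF inj(1)])
  have c2: "functional_code (schema_props x v) \<longleftrightarrow> single_valued (vprops SG v)"
    if "v \<in> gverts SG" for v
    using that inj by (simp add: parts functional_code_enc_set finite_props inj_enc_data_type)
  \<comment> \<open>The constant \<open>2\<close> is \<open>enc_data_type Integer\<close>.\<close>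
  have c3: "prod_encode (ea vid, 2) \<in> set_decode (schema_props x v) \<longleftrightarrow>
      (vid, Integer) \<in> vprops SG v" if "v \<in> gverts SG" for v
    using that enc_pair_mem_iff[OF inj(2) inj_enc_data_type, of vid Integer]
    by (simp add: enc_data_type_def)
  have c4: "(\<exists>p\<in>set_decode (schema_props x v). pfst p = ea tid) \<longleftrightarrow> tid \<in> Domain (vprops SG v)"
    if "v \<in> gverts SG" for v
    using that inj by (force simp: inj_eq)
  have c5: "(\<not> apply_code (schema_part (Suc 0) x) v = 0 \<longrightarrow>
      \<not> mem_code (ea vid) (apply_code (schema_part (Suc 0) x) v - 1)) \<longleftrightarrow>
      (\<forall>as. pk SG v = Some as \<longrightarrow> vid \<notin> set as)" if "v \<in> gverts SG" for v
    using that inj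
    by (simp add: parts enc_option_def enc_list_def mem_code_list_encode inj_image_mem_iff
        split: option.split)
  have c6: "same_length_code (apply_code (schema_part 2 x) e) (apply_code (schema_part 3 x) e) \<longleftrightarrow>
      length (fk_source SG e) = length (fk_dest SG e)" if "e \<in> garcs SG" for e
    using that by (simp add: parts enc_list_def same_length_code_list_encode)
  have c7: "mem_code (ea vid) (apply_code (schema_part 2 x) e) \<longleftrightarrow> vid \<in> set (fk_source SG e)"
    if "e \<in> garcs SG" for e
    using that inj by (simp add: parts enc_list_def mem_code_list_encode inj_image_mem_iff)
  \<comment> \<open>\<open>enc_option\<close> gives \<open>None\<close> the code \<open>0\<close>
    and adds \<open>Suc\<close> otherwise, so one equation tests both that the head has a primary
    key and that it is the target list.\<close>
  have c8: "apply_code (schema_part (Suc 0) x) (apply_code (schema_graph_part 3 x) e) =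
      Suc (apply_code (schema_part 3 x) e) \<longleftrightarrow> pk SG (ghead SG e) = Some (fk_dest SG e)"
    if e: "e \<in> garcs SG" for e
  proof -
    have "inj (enc_list ea)"
      using inj(2) by (auto simp: inj_def enc_list_def list_encode_eq inj_map_eq_map)
    then show ?thesis
      using e arc_verts[OF e] by (simp add: parts enc_option_def inj_eq split: option.split)
  qed
  have c9: "functional_code (instance_props x v) \<longleftrightarrow> single_valued (vprops IG v)"
    if "v \<in> gverts IG" for v
    using that inj by (simp add: parts functional_code_enc_set finite_props)
  have c10: "prod_encode (ea vid, ed null) \<in> set_decode (instance_props x v) \<longleftrightarrow>
      (vid, null) \<in> vprops IG v" if "v \<in> gverts IG" for v
    using that inj by (simp add: enc_pair_mem_iff)
  \<comment> \<open>\<open>set_encode\<close> is injective on finite sets only, hence the appeal to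
    finiteness of the properties.\<close>
  have c11: "(instance_rel x v = schema_rel x w \<longrightarrow>
      set_encode (pfst ` set_decode (instance_props x v)) =
      set_encode (pfst ` set_decode (schema_props x w))) \<longleftrightarrow>
      (rel_of IG v = rel_of SG w \<longrightarrow> Domain (vprops IG v) = Domain (vprops SG w))"
    if "v \<in> gverts IG" "w \<in> gverts SG" for v w
    unfolding decode_props(1)[OF that(2)] decode_props(2)[OF that(1)] pfst_image_enc_pair
    using that inj
    by (simp add: parts(4,11) inj_eq set_encode_eq_iff finite_props finite_Domain inj_image_eq_iff)
  have c12: "(instance_rel x v = instance_rel x w \<longrightarrow>
      (\<exists>p\<in>set_decode (instance_props x v). pfst p = ea vid \<and> p \<in> set_decode (instance_props x w)) \<longrightarrow>
      v = w) \<longleftrightarrow>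
      (rel_of IG v = rel_of IG w \<longrightarrow> (\<exists>c. (vid, c) \<in> vprops IG v \<and> (vid, c) \<in> vprops IG w) \<longrightarrow> v = w)"
    if vw: "v \<in> gverts IG" "w \<in> gverts IG" for v w
  proof -
    have "enc_pair ea ed p \<in> enc_pair ea ed ` P \<longleftrightarrow> p \<in> P" for p P
      using inj by (auto simp: enc_pair_eq_iff simp del: enc_pair_Pair)
    then have "(\<exists>p\<in>set_decode (instance_props x v). pfst p = ea vid \<and> p \<in> set_decode (instance_props x w)) \<longleftrightarrow>
        (\<exists>p\<in>vprops IG v. fst p = vid \<and> p \<in> vprops IG w)"
      using vw inj by (simp add: inj_eq)
    also have "\<dots> \<longleftrightarrow> (\<exists>c. (vid, c) \<in> vprops IG v \<and> (vid, c) \<in> vprops IG w)"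
      by force
    finally show ?thesis
      using vw inj by (simp add: parts(11) inj_eq)
  qed
  show ?thesis
    unfolding decodable_code_def decodable_db_def prod.case parts(1-3)
    by (intro arg_cong2[where f = "(\<and>)"] arg_cong[where f = Not] ball_cong[OF refl] c1 c2 c3 c4 c5 c6 c7 c8 c9 c10 c11 c12)
qed

text \<open>Every field of the result is the code of a set, so it suffices that
  \<open>decode_code\<close> forms the same set of numbers; \<open>e1\<close> to \<open>e5\<close>
  do this field by field.\<close>

lemma enc_decode:
  assumes decodable: "decodable_db tid vid null (SG, IG)"
  shows "enc_rel_db tid er ea ed (decode_db tid vid (SG, IG)) = decode_code (ea tid) (ea vid) x"
proof -
  let ?S = "decode_schema vid SG" and ?I = "snd (decode_db tid vid (SG, IG))"
  note decode_facts = attrs_decode_schema[OF graph_db decodable]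
    attr_type_decode_schema[OF graph_db decodable]
  have inj_rel: "inj_on (rel_of SG) (gverts SG)"
    and sv: "v \<in> gverts SG \<Longrightarrow> single_valued (vprops SG v)" for v
    using decodable by (simp_all add: decodable_db_def)
  have proper: "{p \<in> enc_pair ea enc_data_type ` vprops SG v. \<not> pfst p = ea vid} =
      enc_pair ea enc_data_type ` proper_props vid (vprops SG v)" for v
    using inj by (auto simp: proper_props_def inj_eq)
  have fin_proper: "finite (proper_props vid (vprops SG v))" if "v \<in> gverts SG" for v
    using finite_props(1)[OF that] by (simp add: proper_props_def)
  have rels: "rels ?S = rel_of SG ` gverts SG"
    by (simp add: decode_schema_def)

  have e1: "enc_set er (rels ?S) = set_encode (schema_rel x ` gverts SG)"
    unfolding enc_set_def rels image_image
    by (intro arg_cong[where f = set_encode] image_cong refl) (simp add: parts)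
  have e2: "enc_fun (rels ?S) er (enc_set ea) (attrs ?S) =
      set_encode ((\<lambda>v. prod_encode (schema_rel x v,
        set_encode (pfst ` {p \<in> set_decode (schema_props x v). \<not> pfst p = ea vid}))) ` gverts SG)"
    unfolding enc_fun_def enc_set_def rels image_image
    by (intro arg_cong[where f = set_encode] image_cong refl)
      (simp add: proper pfst_image_enc_pair parts(4) decode_facts Domain_proper_props)
  have e3: "enc_fun (SIGMA r:rels ?S. attrs ?S r) (enc_pair er ea) enc_data_type
       (\<lambda>(r, a). attr_type ?S r a) =
      set_encode (\<Union>v\<in>gverts SG. set_decode (
         set_encode ((\<lambda>p. prod_encode (prod_encode (schema_rel x v, pfst p), psnd p)) `
           {p \<in> set_decode (schema_props x v). \<not> pfst p = ea vid})))"
  proof -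
    \<comment> \<open>The type table splits by relation, and the part of one vertex is its property
      set without \<open>vid\<close>, each pair tagged with the relation.\<close>
    have "(\<lambda>(r, a). ((r, a), attr_type ?S r a)) ` (SIGMA r:rels ?S. attrs ?S r) =
        (\<Union>r\<in>rels ?S. (\<lambda>a. ((r, a), attr_type ?S r a)) ` attrs ?S r)"
      by (auto simp: image_iff)
    also have "\<dots> = (\<Union>v\<in>gverts SG. (\<lambda>a. ((rel_of SG v, a), attr_type ?S (rel_of SG v) a)) `
        attrs ?S (rel_of SG v))"
      by (simp add: rels)
    also have "\<dots> = (\<Union>v\<in>gverts SG. (\<lambda>a. ((rel_of SG v, a), fun_of (proper_props vid (vprops SG v)) a)) `
          Domain (proper_props vid (vprops SG v)))"
      by (intro SUP_cong refl) (simp add: decode_facts Domain_proper_props)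
    also have "\<dots> = (\<Union>v\<in>gverts SG. (\<lambda>(a, ty). ((rel_of SG v, a), ty)) `
        (\<lambda>a. (a, fun_of (proper_props vid (vprops SG v)) a)) ` Domain (proper_props vid (vprops SG v)))"
      by (simp add: image_image)
    also have "\<dots> = (\<Union>v\<in>gverts SG. (\<lambda>(a, ty). ((rel_of SG v, a), ty)) ` proper_props vid (vprops SG v))"
      by (intro SUP_cong refl arg_cong2[where f = image] graph_fun_of single_valued_proper_props sv)
    finally have "enc_fun (SIGMA r:rels ?S. attrs ?S r) (enc_pair er ea) enc_data_type
         (\<lambda>(r, a). attr_type ?S r a) =
        set_encode (enc_pair (enc_pair er ea) enc_data_type `
          (\<Union>v\<in>gverts SG. (\<lambda>(a, ty). ((rel_of SG v, a), ty)) ` proper_props vid (vprops SG v)))"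
      by (simp add: enc_fun_def enc_set_def split_def)
    also have "enc_pair (enc_pair er ea) enc_data_type `
          (\<Union>v\<in>gverts SG. (\<lambda>(a, ty). ((rel_of SG v, a), ty)) ` proper_props vid (vprops SG v)) =
        (\<Union>v\<in>gverts SG. set_decode (
         set_encode ((\<lambda>p. prod_encode (prod_encode (schema_rel x v, pfst p), psnd p)) `
           {p \<in> set_decode (schema_props x v). \<not> pfst p = ea vid})))"
      unfolding image_UN image_image
      by (intro SUP_cong refl)
        (simp add: proper fin_proper image_image parts(4) split_def)
    finally show ?thesis .
  qed
  have e4: "enc_set (enc_key er ea) (keys ?S) = set_encode (
         set_decode (set_encode (
           (\<lambda>v. list_encode [schema_rel x v, apply_code (schema_part (Suc 0) x) v - 1]) `
           {v \<in> gverts SG. \<not> apply_code (schema_part (Suc 0) x) v = 0})) \<union>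
         set_decode (set_encode (
           (\<lambda>e. list_encode [
              schema_rel x (apply_code (schema_graph_part 2 x) e), apply_code (schema_part 2 x) e,
              schema_rel x (apply_code (schema_graph_part 3 x) e), apply_code (schema_part 3 x) e]) `
           garcs SG)))"
  proof -
    have "{v \<in> gverts SG. \<not> apply_code (schema_part (Suc 0) x) v = 0} = {v \<in> gverts SG. pk SG v \<noteq> None}"
      by (auto simp: parts enc_option_def split: option.splits)
    moreover have "enc_key er ea ` (\<lambda>v. Primary_Key (rel_of SG v) (the (pk SG v))) `
        {v \<in> gverts SG. pk SG v \<noteq> None} =
       (\<lambda>v. list_encode [schema_rel x v, apply_code (schema_part (Suc 0) x) v - 1]) `
        {v \<in> gverts SG. pk SG v \<noteq> None}"
      unfolding image_image
      by (intro image_cong refl) (auto simp: enc_key_def parts enc_option_def simp del: list_encode.simps)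
    moreover have "enc_key er ea ` (\<lambda>e. Foreign_Key (rel_of SG (gtail SG e)) (fk_source SG e)
         (rel_of SG (ghead SG e)) (fk_dest SG e)) ` garcs SG =
       (\<lambda>e. list_encode [
              schema_rel x (apply_code (schema_graph_part 2 x) e), apply_code (schema_part 2 x) e,
              schema_rel x (apply_code (schema_graph_part 3 x) e), apply_code (schema_part 3 x) e]) `
           garcs SG"
      unfolding image_image
      by (intro image_cong refl) (simp add: enc_key_def parts arc_verts del: list_encode.simps)
    ultimately show ?thesis
      by (simp add: enc_set_def decode_schema_def image_Un finite_graph del: list_encode.simps)
  qed
  have e5: "enc_set (\<lambda>(r, t). prod_encode (er r, enc_fun (insert tid (attrs ?S r)) ea ed t))
       (SIGMA r:rels ?S. ?I r) =
     set_encode ((\<lambda>v. prod_encode (instance_rel x v,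
         set_encode ((\<lambda>p. prod_encode (if pfst p = ea vid then ea tid else pfst p, psnd p)) `
           set_decode (instance_props x v)))) ` gverts IG)"
    unfolding Sigma_decode_tuples[OF graph_db decodable] decode_tuples_def enc_set_def image_image prod.case
  proof (intro arg_cong[where f = set_encode] image_cong refl)
    fix v assume v: "v \<in> gverts IG"
    note props = decode_tuple_props[OF graph_db decodable v]
    have "enc_fun (insert tid (attrs ?S (rel_of IG v))) ea ed (fun_of (tuple_props tid vid (vprops IG v))) =
        set_encode (enc_pair ea ed ` tuple_props tid vid (vprops IG v))"
      using enc_fun_fun_of[OF props(1) props(2)[symmetric]] by (simp add: enc_set_def)
    also have "enc_pair ea ed ` tuple_props tid vid (vprops IG v) =
        (\<lambda>p. prod_encode (if pfst p = ea vid then ea tid else pfst p, psnd p)) ` set_decode (instance_props x v)"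
      unfolding tuple_props_def decode_props(2)[OF v] image_image
      using inj by (intro image_cong refl) (auto simp: enc_pair_def inj_eq split_def)
    finally show "prod_encode (er (rel_of IG v), enc_fun (insert tid (attrs ?S (rel_of IG v))) ea ed
        (fun_of (tuple_props tid vid (vprops IG v)))) = prod_encode (instance_rel x v,
         set_encode ((\<lambda>p. prod_encode (if pfst p = ea vid then ea tid else pfst p, psnd p)) `
           set_decode (instance_props x v)))"
      using v by (simp add: parts)
  qed
  have e6: "decode_db tid vid (SG, IG) = (?S, ?I)"
    by (simp add: decode_db_def)
  have "enc_rel_db tid er ea ed (?S, ?I) = decode_code (ea tid) (ea vid) x"
    unfolding enc_rel_db_def enc_rel_schema_def decode_code_def prod.case parts(1-3) e1 e2 e3 e4 e5 ..
  then show ?thesis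
    by (subst e6)
qed

end

section \<open>Existence of the complete mapping\<close>

text \<open>Transport along a naming \<open>h\<close> of \<open>A\<close> by numbers; the
  restriction supplies the extensionality that property graphs require.\<close>

definition push :: "('x \<Rightarrow> nat) \<Rightarrow> 'x set \<Rightarrow> ('x \<Rightarrow> 'y) \<Rightarrow> nat \<Rightarrow> 'y" where
  "push h A f = (\<lambda>i\<in>h ` A. f (the_inv_into A h i))"

lemma push_eq: "inj_on h A \<Longrightarrow> a \<in> A \<Longrightarrow> push h A f (h a) = f a"
  by (simp add: push_def the_inv_into_f_f)

lemma push_extensional: "push h A f \<in> extensional (h ` A)"
  by (simp add: push_def)

lemma push_PiE: "inj_on h A \<Longrightarrow> (\<And>a. a \<in> A \<Longrightarrow> f a \<in> B (h a)) \<Longrightarrow> push h A f \<in> (\<Pi>\<^sub>E i\<in>h ` A. B i)"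
  by (auto simp: push_eq push_extensional PiE_iff)

lemma wf_property_graph_push:
  assumes "graph G = \<lparr>verts = h ` V, arcs = k ` E, tail = push k E (\<lambda>e. h (src e)),
      head = push k E (\<lambda>e. h (dst e))\<rparr>"
    and "vlabel G = push h V l" "elabel G = push k E m"
    and "vprops G = push h V p" "eprops G = push k E (\<lambda>_. {})"
    and "finite V" "finite E" "inj_on h V" "inj_on k E"
    and "\<And>e. e \<in> E \<Longrightarrow> src e \<in> V \<and> dst e \<in> V" and "\<And>v. v \<in> V \<Longrightarrow> finite (p v)"
  shows "wf_property_graph G"
  using assms unfolding wf_property_graph_def fin_digraph_def fin_digraph_axioms_def wf_digraph_def
  by (auto simp: push_eq push_extensional intro!: push_PiE)

lemma finite_foreign_keys: "finite (keys S) \<Longrightarrow> finite (foreign_keys S)"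
proof -
  assume "finite (keys S)"
  then have "finite ((\<lambda>(r, as, s, bs). Foreign_Key r as s bs) ` foreign_keys S)"
    by (rule finite_subset[rotated]) (auto simp: foreign_keys_def)
  then show ?thesis
    by (rule finite_imageD) (auto simp: inj_on_def)
qed

lemma ex_complete_schema_graph:
  assumes S: "S \<in> rel_schemas tid vid"
  shows "\<exists>SG\<in>schema_graphs. complete_schema_graph vid S SG"
proof -
  note SD = rel_schemasD[OF S]
  let ?F = "foreign_keys S"
  have fin: "finite ?F" using SD(8) by (rule finite_foreign_keys)
  \<comment> \<open>Any numbering of the finitely many relations will do, as identities of vertices
    are not prescribed.\<close>
  obtain h :: "'a \<Rightarrow> nat" where h: "inj_on h (rels S)"
    using SD(1) by (metis finite_imp_inj_to_nat_seg)
  obtain k :: "'a \<times> 'b list \<times> 'a \<times> 'b list \<Rightarrow> nat" where k: "inj_on k ?F"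
    using fin by (metis finite_imp_inj_to_nat_seg)
  have F: "r \<in> rels S" "s \<in> rels S" "set as \<subseteq> attrs S r" "set bs \<subseteq> attrs S s"
    if "(r, as, s, bs) \<in> ?F" for r as s bs
    using that SD(9,11) by (auto simp: foreign_keys_def)
  let ?src = "\<lambda>(r, as, s, bs). r" and ?dst = "\<lambda>(r, as, s, bs). s"
  let ?p = "\<lambda>r. {(a, attr_type S r a) | a. a \<in> attrs S r} \<union> {(vid, Integer)}"
  \<comment> \<open>The description is unique since a relation has at most one primary key.\<close>
  define key where "key = (\<lambda>r. if \<exists>as. Primary_Key r as \<in> keys S
    then Some (THE as. Primary_Key r as \<in> keys S) else None)"
  have key: "key r = Some as \<longleftrightarrow> Primary_Key r as \<in> keys S" for r as
  proof -
    have "(THE as. Primary_Key r as \<in> keys S) = bs" if "Primary_Key r bs \<in> keys S" for bs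
      using that SD(10) by (intro the_equality) auto
    then show ?thesis by (auto simp: key_def)
  qed
  define SG :: "('a, 'b) schema_graph" where "SG = \<lparr>
    graph = \<lparr>verts = h ` rels S, arcs = k ` ?F, tail = push k ?F (\<lambda>e. h (?src e)),
      head = push k ?F (\<lambda>e. h (?dst e))\<rparr>,
    vlabel = push h (rels S) Name, elabel = push k ?F (\<lambda>(r, as, s, bs). Dash r s),
    vprops = push h (rels S) ?p, eprops = push k ?F (\<lambda>_. {}),
    pk = push h (rels S) key,
    fk_source = push k ?F (\<lambda>(r, as, s, bs). as), fk_dest = push k ?F (\<lambda>(r, as, s, bs). bs)\<rparr>"
  have "wf_property_graph SG"
  proof (rule wf_property_graph_push[where h = h and k = k])
    show "finite (?p r)" if "r \<in> rels S" for r
      using SD(4)[OF that] by simp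
    show "?src e \<in> rels S \<and> ?dst e \<in> rels S" if "e \<in> ?F" for e
      using that F by (cases e) simp
  qed (simp_all add: SG_def SD(1) fin h k)
  moreover have attr: "attrs S r \<subseteq> fst ` ?p r" for r
    by force
  have "\<forall>v\<in>gverts SG. \<forall>as. pk SG v = Some as \<longrightarrow> set as \<subseteq> fst ` vprops SG v"
    using SD(9) attr by (simp add: SG_def push_eq h key) blast
  moreover have "fk_source SG \<in> (\<Pi>\<^sub>E e\<in>garcs SG. {as. set as \<subseteq> fst ` vprops SG (gtail SG e)})"
    unfolding SG_def schema_graph.simps property_graph.simps pre_digraph.simps
  proof (rule push_PiE[OF k])
    fix e assume e: "e \<in> ?F"
    obtain r as s bs where [simp]: "e = (r, as, s, bs)" by (cases e)
    show "(case e of (r, as, s, bs) \<Rightarrow> as) \<in>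
      {as. set as \<subseteq> fst ` push h (rels S) ?p (push k ?F (\<lambda>e. h (?src e)) (k e))}"
      using e F(1,3)[of r as s bs] attr[of r] by (simp add: push_eq[OF k] push_eq[OF h] del: Un_insert_right)
  qed
  moreover have "fk_dest SG \<in> (\<Pi>\<^sub>E e\<in>garcs SG. {as. set as \<subseteq> fst ` vprops SG (ghead SG e)})"
    unfolding SG_def schema_graph.simps property_graph.simps pre_digraph.simps
  proof (rule push_PiE[OF k])
    fix e assume e: "e \<in> ?F"
    obtain r as s bs where [simp]: "e = (r, as, s, bs)" by (cases e)
    show "(case e of (r, as, s, bs) \<Rightarrow> bs) \<in>
      {as. set as \<subseteq> fst ` push h (rels S) ?p (push k ?F (\<lambda>e. h (?dst e)) (k e))}"
      using e F(2,4)[of r as s bs] attr[of s] by (simp add: push_eq[OF k] push_eq[OF h] del: Un_insert_right)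
  qed
  moreover have "pk SG \<in> extensional (gverts SG)"
    by (simp add: SG_def push_extensional)
  ultimately have "SG \<in> schema_graphs"
    by (simp add: schema_graphs_def)
  moreover have "complete_schema_graph vid S SG"
    unfolding complete_schema_graph_def
  proof (intro exI conjI)
    show "bij_betw h (rels S) (gverts SG)" "bij_betw k ?F (garcs SG)"
      by (simp_all add: SG_def bij_betw_def h k)
    show "\<forall>r\<in>rels S. vlabel SG (h r) = Name r \<and> vprops SG (h r) = ?p r \<and>
        (\<forall>as. (pk SG (h r) = Some as) = (Primary_Key r as \<in> keys S))"
      by (simp add: SG_def push_eq h key)
    show "\<forall>(r, as, s, bs)\<in>?F. let e = k (r, as, s, bs) in gtail SG e = h r \<and> ghead SG e = h s \<and>
        elabel SG e = Dash r s \<and> eprops SG e = {} \<and> fk_source SG e = as \<and> fk_dest SG e = bs"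
      by (auto simp: SG_def push_eq k)
  qed
  ultimately show ?thesis by blast
qed

text \<open>Works over every complete schema graph: the vertex of a tuple corresponds to that of its
  relation, and an edge stemming from a foreign key corresponds to the schema edge of that
  key.\<close>

lemma ex_complete_instance_graph:
  assumes D: "(S, I) \<in> rel_dbs tid vid null vals" and SG: "complete_schema_graph vid S SG"
  shows "\<exists>IG\<in>instance_graphs vals SG. complete_instance_graph tid vid S I IG"
proof -
  have S: "S \<in> rel_schemas tid vid" and I: "I \<in> rel_instances tid null vals S"
    using D by (simp_all add: rel_dbs_def)
  note SD = rel_schemasD[OF S]
  let ?V = "SIGMA r:rels S. I r"
  define E where "E = {(k, t, t') | k t t'. case k of (r, as, s, bs) \<Rightarrow>
          k \<in> foreign_keys S \<and> t \<in> I r \<and> t' \<in> I s \<and> map t as = map t' bs}"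
  have E: "((r, as, s, bs), t, t') \<in> E \<longleftrightarrow> (r, as, s, bs) \<in> foreign_keys S \<and>
      t \<in> I r \<and> t' \<in> I s \<and> map t as = map t' bs" for r as s bs t t'
    by (simp add: E_def)
  have F: "r \<in> rels S" "s \<in> rels S" if "(r, as, s, bs) \<in> foreign_keys S" for r as s bs
    using that SD(11) by (auto simp: foreign_keys_def)
  have finI: "finite (I r)" if "r \<in> rels S" for r
    using I that by (auto simp: rel_instances_def)
  with SD(1) have finV: "finite ?V" by auto
  have sub: "E \<subseteq> foreign_keys S \<times> snd ` ?V \<times> snd ` ?V"
    using F by (fastforce simp: E image_iff)
  have finE: "finite E"
    by (rule finite_subset[OF sub])
      (intro finite_cartesian_product finite_imageI finV finite_foreign_keys SD(8))
  obtain h :: "'a \<times> ('b \<Rightarrow> 'c) \<Rightarrow> nat" where h: "inj_on h ?V"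
    using finV by (metis finite_imp_inj_to_nat_seg)
  obtain k :: "('a \<times> 'b list \<times> 'a \<times> 'b list) \<times> ('b \<Rightarrow> 'c) \<times> ('b \<Rightarrow> 'c) \<Rightarrow> nat" where k: "inj_on k E"
    using finite_imp_inj_to_nat_seg[OF finE] by (elim exE conjE) (rule that)
  let ?src = "\<lambda>((r, as, s, bs), t, t'). (r, t)" and ?dst = "\<lambda>((r, as, s, bs), t, t'). (s, t')"
  let ?p = "\<lambda>(r, t). {(a, t a) | a. a \<in> attrs S r} \<union> {(vid, t tid)}"
  define IG :: "('a, 'b \<times> 'c) property_graph" where "IG = \<lparr>
    graph = \<lparr>verts = h ` ?V, arcs = k ` E, tail = push k E (\<lambda>e. h (?src e)),
      head = push k E (\<lambda>e. h (?dst e))\<rparr>,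
    vlabel = push h ?V (\<lambda>(r, t). Name r), elabel = push k E (\<lambda>((r, as, s, bs), t, t'). Dash r s),
    vprops = push h ?V ?p, eprops = push k E (\<lambda>_. {})\<rparr>"
  have "wf_property_graph IG"
  proof (rule wf_property_graph_push[where h = h and k = k])
    show "finite (?p v)" if "v \<in> ?V" for v
      using SD(4) that by (cases v) auto
    show "?src e \<in> ?V \<and> ?dst e \<in> ?V" if e: "e \<in> E" for e
    proof -
      obtain r as s bs t t' where [simp]: "e = ((r, as, s, bs), t, t')" by (metis surj_pair)
      show ?thesis using e F[of r as s bs] by (simp add: E)
    qed
  qed (simp_all add: IG_def finV finE h k)

  from SG obtain vS eS where
    vS: "bij_betw vS (rels S) (gverts SG)" and eS: "bij_betw eS (foreign_keys S) (garcs SG)"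
    and v: "\<forall>r\<in>rels S. vlabel SG (vS r) = Name r \<and>
      vprops SG (vS r) = {(a, attr_type S r a) | a. a \<in> attrs S r} \<union> {(vid, Integer)} \<and>
      (\<forall>as. pk SG (vS r) = Some as \<longleftrightarrow> Primary_Key r as \<in> keys S)"
    and e: "\<forall>(r, as, s, bs)\<in>foreign_keys S. let e = eS (r, as, s, bs) in
      gtail SG e = vS r \<and> ghead SG e = vS s \<and> elabel SG e = Dash r s \<and> eprops SG e = {} \<and>
      fk_source SG e = as \<and> fk_dest SG e = bs"
    unfolding complete_schema_graph_def by blast
  have e': "gtail SG (eS (r, as, s, bs)) = vS r" "ghead SG (eS (r, as, s, bs)) = vS s"
    "elabel SG (eS (r, as, s, bs)) = Dash r s"
    if "(r, as, s, bs) \<in> foreign_keys S" for r as s bs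
    using e that by (auto simp: Let_def)
  have vert: "vlabel IG (h (r, t)) = Name r"
    "vprops IG (h (r, t)) = {(a, t a) | a. a \<in> attrs S r} \<union> {(vid, t tid)}"
    if "r \<in> rels S" "t \<in> I r" for r t
    using that by (simp_all add: IG_def push_eq[OF h])
  have corr: "vertex_corresponds vals SG IG (h (r, t)) (vS r)" if r: "r \<in> rels S" "t \<in> I r" for r t
  proof -
    have "t \<in> rel_tuples tid null vals S r"
      using I r by (auto simp: rel_instances_def)
    then have *: "\<forall>a\<in>insert tid (attrs S r). t a \<in> (if a = tid then vals Integer - {null} else vals (attr_type S r a))"
      unfolding rel_tuples_def by (auto simp only: PiE_iff)
    with SD(5)[OF r(1)] have "t a \<in> vals (attr_type S r a)" if "a \<in> attrs S r" for a
      using that by (auto split: if_splits)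
    moreover from * have "t tid \<in> vals Integer" by simp
    ultimately show ?thesis
      using r v by (auto simp: vertex_corresponds_def vert props_conform_def)
  qed
  have arc: "gtail IG (k ((r, as, s, bs), t, t')) = h (r, t)"
    "ghead IG (k ((r, as, s, bs), t, t')) = h (s, t')"
    "elabel IG (k ((r, as, s, bs), t, t')) = Dash r s"
    "eprops IG (k ((r, as, s, bs), t, t')) = {}"
    if "(r, as, s, bs) \<in> foreign_keys S" "t \<in> I r" "t' \<in> I s" "map t as = map t' bs" for r as s bs t t'
    using that by (simp_all add: IG_def push_eq[OF k] E)
  have "\<exists>w\<in>gverts SG. vertex_corresponds vals SG IG u w" if "u \<in> gverts IG" for u
  proof -
    obtain r t where "r \<in> rels S" "t \<in> I r" "u = h (r, t)"
      using \<open>u \<in> gverts IG\<close> by (auto simp: IG_def)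
    with corr[of r t] vS show ?thesis by (auto simp: bij_betw_def)
  qed
  moreover have "\<exists>f\<in>garcs SG. edge_corresponds vals SG IG e f" if "e \<in> garcs IG" for e
  proof -
    have "e \<in> k ` E" using that by (simp add: IG_def)
    then obtain c where c: "c \<in> E" "e = k c" by blast
    obtain r as s bs t t' where "c = ((r, as, s, bs), t, t')" by (metis surj_pair)
    with c have k: "(r, as, s, bs) \<in> foreign_keys S" "t \<in> I r" "t' \<in> I s"
      "map t as = map t' bs" "e = k ((r, as, s, bs), t, t')"
      by (simp_all add: E)
    then have "edge_corresponds vals SG IG e (eS (r, as, s, bs))"
      using F[OF k(1)] corr by (simp add: edge_corresponds_def arc e' props_conform_def)
    moreover have "eS (r, as, s, bs) \<in> garcs SG"
      using k(1) eS by (auto simp: bij_betw_def)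
    ultimately show ?thesis by blast
  qed
  ultimately have "IG \<in> instance_graphs vals SG"
    using \<open>wf_property_graph IG\<close> by (simp add: instance_graphs_def)
  moreover have "complete_instance_graph tid vid S I IG"
    unfolding complete_instance_graph_def E_def[symmetric]
  proof (intro exI conjI)
    show "bij_betw h ?V (gverts IG)" "bij_betw k E (garcs IG)"
      using h k by (simp_all add: IG_def bij_betw_def)
    show "\<forall>r\<in>rels S. \<forall>t\<in>I r. vlabel IG (h (r, t)) = Name r \<and>
        vprops IG (h (r, t)) = {(a, t a) | a. a \<in> attrs S r} \<union> {(vid, t tid)}"
      by (simp add: vert)
    show "\<forall>(r, as, s, bs)\<in>foreign_keys S. \<forall>t\<in>I r. \<forall>t'\<in>I s. map t as = map t' bs \<longrightarrow>
        (let e = k ((r, as, s, bs), t, t') in gtail IG e = h (r, t) \<and> ghead IG e = h (s, t') \<and>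
          elabel IG e = Dash r s \<and> eprops IG e = {})"
      by (auto simp: arc Let_def simp del: map_eq_conv)
  qed
  ultimately show ?thesis by blast
qed

text \<open>Keeps the statement about all complete mappings from being vacuous. Names are chosen for
  each database separately.\<close>

lemma ex_complete_mapping:
  "\<exists>CM :: ('r, 'a, 'd) rel_db \<Rightarrow> ('r, 'a, 'd) graph_db. complete_mapping tid vid null vals CM"
proof -
  let ?complete = "\<lambda>(D :: ('r, 'a, 'd) rel_db) (G :: ('r, 'a, 'd) graph_db). G \<in> graph_dbs vals \<and>
    complete_schema_graph vid (fst D) (fst G) \<and> complete_instance_graph tid vid (fst D) (snd D) (snd G)"
  have "\<exists>G. ?complete D G" if D: "D \<in> rel_dbs tid vid null vals"
    for D :: "('r, 'a, 'd) rel_db"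
  proof -
    from D have "fst D \<in> rel_schemas tid vid" by (auto simp: rel_dbs_def)
    from ex_complete_schema_graph[OF this] obtain SG
      where SG: "SG \<in> schema_graphs" "complete_schema_graph vid (fst D) SG" by blast
    from D have "(fst D, snd D) \<in> rel_dbs tid vid null vals" by simp
    from ex_complete_instance_graph[OF this SG(2)] obtain IG
      where "IG \<in> instance_graphs vals SG" "complete_instance_graph tid vid (fst D) (snd D) IG" by blast
    with SG have "?complete D (SG, IG)" by (simp add: graph_dbs_def)
    then show ?thesis ..
  qed
  then have "\<forall>D\<in>rel_dbs tid vid null vals. \<exists>G. ?complete D G" by blast
  from bchoice[OF this] obtain CM
    where CM: "\<forall>D\<in>rel_dbs tid vid null vals. ?complete D (CM D)" by blast
  have "complete_mapping tid vid null vals CM"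
    unfolding complete_mapping_def
  proof (intro conjI ballI)
    show "CM \<in> rel_dbs tid vid null vals \<rightarrow> graph_dbs vals" using CM by blast
    fix D :: "('r, 'a, 'd) rel_db" assume "D \<in> rel_dbs tid vid null vals"
    with CM have "?complete D (CM D)" by blast
    then show "case D of (S, I) \<Rightarrow> case CM (S, I) of (SG, IG) \<Rightarrow>
        complete_schema_graph vid S SG \<and> complete_instance_graph tid vid S I IG"
      by (simp add: split_def)
  qed
  then show ?thesis by blast
qed

theorem theorem1:
  fixes tid vid :: 'a
    and null :: 'd
    and vals :: "data_type \<Rightarrow> 'd set"
    and er :: "'r \<Rightarrow> nat" and ea :: "'a \<Rightarrow> nat" and ed :: "'d \<Rightarrow> nat"
  assumes "infinite (UNIV :: 'r set)" and "infinite (UNIV :: 'a set)"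
    and "infinite (UNIV :: 'd set)"
    and "inj er" and "inj ea" and "inj ed"
    and "tid \<noteq> vid"
    and "\<And>ty. null \<in> vals ty"
  shows "(\<exists>CM :: ('r, 'a, 'd) rel_db \<Rightarrow> ('r, 'a, 'd) graph_db.
            complete_mapping tid vid null vals CM) \<and>
         (\<forall>CM :: ('r, 'a, 'd) rel_db \<Rightarrow> ('r, 'a, 'd) graph_db.
            complete_mapping tid vid null vals CM \<longrightarrow>
            (\<exists>CMinv. CMinv \<in> graph_dbs vals \<rightarrow> rel_dbs tid vid null vals \<and>
               computable_on (graph_dbs vals) (enc_graph_db er ea ed) (enc_rel_db tid er ea ed) CMinv \<and>
               (\<forall>D\<in>rel_dbs tid vid null vals. CMinv (CM D) = D)))"
proof (intro conjI allI impI)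
  show "\<exists>CM :: ('r, 'a, 'd) rel_db \<Rightarrow> ('r, 'a, 'd) graph_db. complete_mapping tid vid null vals CM"
    by (rule ex_complete_mapping)
next
  fix CM :: "('r, 'a, 'd) rel_db \<Rightarrow> ('r, 'a, 'd) graph_db"
  assume CM: "complete_mapping tid vid null vals CM"
  let ?empty = "(\<lparr>rels = {}, attrs = \<lambda>_. undefined, attr_type = \<lambda>_. undefined, keys = {}\<rparr>,
    \<lambda>_. undefined) :: ('r, 'a, 'd) rel_db"
  \<comment> \<open>The definition does not mention \<open>CM\<close>, so this inverse is the same
    for all complete mappings.\<close>
  define CMinv :: "('r, 'a, 'd) graph_db \<Rightarrow> ('r, 'a, 'd) rel_db"
    where "CMinv = (\<lambda>G. if decodable_db tid vid null G then decode_db tid vid G else ?empty)"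
  have empty: "?empty \<in> rel_dbs tid vid null vals"
    by (simp add: rel_dbs_def rel_schemas_def rel_instances_def)
  have "CMinv \<in> graph_dbs vals \<rightarrow> rel_dbs tid vid null vals"
  proof
    fix G :: "('r, 'a, 'd) graph_db" assume "G \<in> graph_dbs vals"
    then show "CMinv G \<in> rel_dbs tid vid null vals"
      using rel_dbs_decode_db[of "fst G" "snd G"] empty by (simp add: CMinv_def)
  qed
  moreover have "computable_on (graph_dbs vals) (enc_graph_db er ea ed) (enc_rel_db tid er ea ed) CMinv"
  proof -
    \<comment> \<open>The code of the empty database enters as a constant. \<open>?f\<close> is
      total, but its values matter only on codes of graph databases.\<close>
    let ?f = "\<lambda>x. if decodable_code (ea tid) (ea vid) (ed null) x
      then decode_code (ea tid) (ea vid) x else enc_rel_db tid er ea ed ?empty"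
    have "recursive ?f"
      by (intro recursive_if decidable_decodable_code recursive_decode_code recursive_const)
    then obtain p where p: "rec_eval p [x] (?f x)" for x
      unfolding computes_def by blast
    have eq: "?f (enc_graph_db er ea ed G) = enc_rel_db tid er ea ed (CMinv G)"
      if "G \<in> graph_dbs vals" for G :: "('r, 'a, 'd) graph_db"
    proof -
      have G: "(fst G, snd G) \<in> graph_dbs vals" using that by simp
      note inj = \<open>inj er\<close> \<open>inj ea\<close> \<open>inj ed\<close>
      have "decodable_code (ea tid) (ea vid) (ed null) (enc_graph_db er ea ed G) \<longleftrightarrow>
          decodable_db tid vid null G"
        using decodable_code_iff[OF inj G refl] by simp
      moreover have "decodable_db tid vid null G \<Longrightarrow>
          enc_rel_db tid er ea ed (decode_db tid vid G) =
          decode_code (ea tid) (ea vid) (enc_graph_db er ea ed G)"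
        using enc_decode[OF inj G refl] by simp
      ultimately show ?thesis by (simp add: CMinv_def)
    qed
    have "rec_eval p [enc_graph_db er ea ed G] (enc_rel_db tid er ea ed (CMinv G))"
      if "G \<in> graph_dbs vals" for G :: "('r, 'a, 'd) graph_db"
      using p[of "enc_graph_db er ea ed G"] unfolding eq[OF that] .
    then show ?thesis
      unfolding computable_on_def by blast
  qed
  moreover have "CMinv (CM D) = D" if D: "D \<in> rel_dbs tid vid null vals"
    for D :: "('r, 'a, 'd) rel_db"
  proof -
    obtain S I SG IG where SI: "D = (S, I)" and G: "CM D = (SG, IG)" by (metis surj_pair)
    from bspec[OF conjunct2[OF CM[unfolded complete_mapping_def]] D]
    have complete: "complete_schema_graph vid S SG" "complete_instance_graph tid vid S I IG"
      using G by (simp_all add: SI)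
    have SI_db: "(S, I) \<in> rel_dbs tid vid null vals"
      using D by (simp add: SI)
    show ?thesis
      using decodable_complete[OF \<open>tid \<noteq> vid\<close> SI_db complete]
        decode_complete[OF \<open>tid \<noteq> vid\<close> SI_db complete]
      by (simp add: CMinv_def G flip: SI)
  qed
  ultimately show "\<exists>CMinv. CMinv \<in> graph_dbs vals \<rightarrow> rel_dbs tid vid null vals \<and>
      computable_on (graph_dbs vals) (enc_graph_db er ea ed) (enc_rel_db tid er ea ed) CMinv \<and>
      (\<forall>D\<in>rel_dbs tid vid null vals. CMinv (CM D) = D)"
    by blast
qed

end
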